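(* Let $\mathrm{char}(\mathbb F)=p>0$ and $h=x^m$, where $m=kp+n$ with $k\ge0$ and $0\le n<p$. Let $\mathsf S=\mathrm{span}_{\mathbb F}\{x^i\mid 0\le i<m,\ i\not\equiv n-1\bmod p\}$ and $\mathcal D_{\mathsf S}=\{D_s\mid s\in\mathsf S\}$. Then (i) $\mathrm{Der}_{\mathbb F}(A_h)=\mathsf Z(A_h)D_{x^{p-1}}\oplus\mathsf Z(A_h)x^{m(p-1)}E_x\oplus\mathcal D_{\mathsf S}\oplus\{\mathrm{ad}_a\mid a\in\mathsf N_{A_1}(A_h)\}$ if $n=0$; (ii) $\mathrm{Der}_{\mathbb F}(A_h)=\mathsf Z(A_h)D_{x^{n-1}}\oplus\mathsf Z(A_h)x^{(m-k)p}E_x\oplus\mathcal D_{\mathsf S}\oplus\{\mathrm{ad}_a\mid a\in\mathsf N_{A_1}(A_h)\}$ if $1\le n<p$.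
   Context: $\mathbb F$ is a field of characteristic $p>0$. The Weyl algebra $A_1$ is the unital associative $\mathbb F$-algebra with generators $x,y$ and relation $yx-xy=1$. For $0\neq h\in\mathbb F[x]$, $A_h$ is the unital associative $\mathbb F$-algebra with generators $x,\hat y$ and relation $\hat yx-x\hat y=h$; it is identified with the subalgebra of $A_1$ generated by $x$ and $\hat y=yh$. The center of $A_h$ is $\mathsf Z(A_h)=\mathbb F[x^p,h^py^p]$. For $r\in\mathbb F[x]$, $D_r$ is the derivation of $A_h$ with $D_r(x)=0$, $D_r(\hat y)=r$. $E_x\in\mathrm{Der}_{\mathbb F}(A_1)$ is given by $E_x(x)=y^{p-1}$, $E_x(y)=0$; the displayed multiples of $E_x$ restrict to derivations of $A_h$. With $\mathrm{ad}_u(v)=[u,v]=uv-vu$, $\mathsf N_{A_1}(A_h)=\{u\in A_1\mid[u,A_h]\subseteq A_h\}$; for $u$ in it, $\mathrm{ad}_u$ is regarded as a derivation of $A_h$. *)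

theory Defs
  imports
    "HOL-Library.Poly_Mapping"
    "HOL-Library.Function_Algebras"
    "HOL-Computational_Algebra.Computational_Algebra"
    "HOL-Number_Theory.Cong"
begin

section \<open>The free algebra on two generators\<close>

text \<open>Finitely supported functions multiply by convolution along the addition of the
  index monoid. Words under concatenation, written additively, therefore make
  \<open>weyl_gen word \<Rightarrow>\<^sub>0 'f\<close> the free unital associative algebra on two generators.\<close>

datatype weyl_gen = GX | GY

datatype 'g word = Word (letters: "'g list")

instantiation word :: (type) monoid_add
begin

definition "0 = Word []"
definition "u + v = Word (letters u @ letters v)"

instance
  by standard (auto simp: zero_word_def plus_word_def)

end

type_synonym 'f free_alg = "weyl_gen word \<Rightarrow>\<^sub>0 'f"

abbreviation free_gen :: "weyl_gen \<Rightarrow> 'f::field free_alg" where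
  "free_gen g \<equiv> Poly_Mapping.single (Word [g]) 1"

definition two_sided_ideal :: "'r::ring_1 set \<Rightarrow> bool" where
  "two_sided_ideal I \<longleftrightarrow>
     0 \<in> I \<and> (\<forall>a\<in>I. \<forall>b\<in>I. a + b \<in> I) \<and> (\<forall>r. \<forall>a\<in>I. r * a \<in> I \<and> a * r \<in> I)"

lemma two_sided_ideal_hull: "two_sided_ideal (two_sided_ideal hull G)"
  by (rule hull_in) (auto simp: two_sided_ideal_def)

definition weyl_ideal :: "'f::field free_alg set" where
  "weyl_ideal = two_sided_ideal hull {free_gen GY * free_gen GX - free_gen GX * free_gen GY - 1}"

lemma
  shows weyl_ideal_0: "0 \<in> weyl_ideal"
    and weyl_ideal_add: "a \<in> weyl_ideal \<Longrightarrow> b \<in> weyl_ideal \<Longrightarrow> a + b \<in> weyl_ideal"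
    and weyl_ideal_mult_left: "a \<in> weyl_ideal \<Longrightarrow> r * a \<in> weyl_ideal"
    and weyl_ideal_mult_right: "a \<in> weyl_ideal \<Longrightarrow> a * r \<in> weyl_ideal"
  using two_sided_ideal_hull[of "{free_gen GY * free_gen GX - free_gen GX * free_gen GY - 1}"]
  by (auto simp: two_sided_ideal_def weyl_ideal_def)

lemma weyl_ideal_uminus: "a \<in> weyl_ideal \<Longrightarrow> - a \<in> weyl_ideal"
  using weyl_ideal_mult_left[of a "- 1"] by simp


text \<open>The representation on polynomials, with \<open>x\<close> acting by multiplication and \<open>y\<close> by
  differentiation, shows that the ideal is proper.\<close>

primrec weyl_act :: "weyl_gen list \<Rightarrow> 'f::field poly \<Rightarrow> 'f poly" where
  "weyl_act [] q = q"
| "weyl_act (g # w) q = (case g of GX \<Rightarrow> [:0, 1:] * weyl_act w q | GY \<Rightarrow> pderiv (weyl_act w q))"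

definition free_act :: "'f::field free_alg \<Rightarrow> 'f poly \<Rightarrow> 'f poly" where
  "free_act f q = (\<Sum>w\<in>Poly_Mapping.keys f. smult (Poly_Mapping.lookup f w) (weyl_act (letters w) q))"

lemma weyl_act_append: "weyl_act (u @ v) q = weyl_act u (weyl_act v q)"
  by (induction u) (auto split: weyl_gen.split)

lemma weyl_act_add: "weyl_act u (a + b) = weyl_act u a + weyl_act u b"
  by (induction u) (auto simp: pderiv_add distrib_left split: weyl_gen.split)

lemma weyl_act_smult: "weyl_act u (smult c a) = smult c (weyl_act u a)"
  by (induction u) (auto simp: pderiv_smult split: weyl_gen.split)

lemma free_act_superset:
  assumes "finite A" "Poly_Mapping.keys f \<subseteq> A"
  shows "free_act f q = (\<Sum>w\<in>A. smult (Poly_Mapping.lookup f w) (weyl_act (letters w) q))"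
  unfolding free_act_def by (rule sum.mono_neutral_left) (use assms in \<open>auto simp: in_keys_iff\<close>)

lemma free_act_0: "free_act 0 q = 0"
  by (simp add: free_act_def)

lemma free_act_single: "free_act (Poly_Mapping.single w c) q = smult c (weyl_act (letters w) q)"
  by (subst free_act_superset[of "{w}"]) auto

lemma free_act_add: "free_act (f + g) q = free_act f q + free_act g q"
proof -
  let ?A = "Poly_Mapping.keys f \<union> Poly_Mapping.keys g"
  have "Poly_Mapping.keys (f + g) \<subseteq> ?A"
    by (rule Poly_Mapping.keys_add)
  then show ?thesis
    using free_act_superset[of ?A "f + g" q] free_act_superset[of ?A f q] free_act_superset[of ?A g q]
    by (simp add: lookup_add smult_add_left sum.distrib)
qed

lemma free_act_diff: "free_act (f - g) q = free_act f q - free_act g q"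
  using free_act_add[of "f - g" g q] by (simp add: algebra_simps)

lemma free_act_arg_add: "free_act f (a + b) = free_act f a + free_act f b"
  by (simp add: free_act_def weyl_act_add smult_add_right sum.distrib)

lemma free_act_arg_smult: "free_act f (smult c a) = smult c (free_act f a)"
proof -
  have "smult c (sum F B) = (\<Sum>w\<in>B. smult c (F w))" for F :: "weyl_gen word \<Rightarrow> 'a poly" and B
    by (induction B rule: infinite_finite_induct) (auto simp: smult_add_right)
  then show ?thesis
    by (simp add: free_act_def weyl_act_smult mult.commute)
qed

lemma free_act_arg_0: "free_act f 0 = 0"
  using free_act_arg_smult[of f 0 0] by simp

lemma free_alg_induct [case_names zero add_single]:
  assumes "P 0" "\<And>f w c. P f \<Longrightarrow> P (f + Poly_Mapping.single w c)"
  shows "P f"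
proof (induction f rule: Poly_Mapping.update_induct)
  case const
  then show ?case by (rule assms(1))
next
  case (update f a b)
  have "Poly_Mapping.update a b f = f + Poly_Mapping.single a b"
    using update(1)
    by (intro poly_mapping_eqI) (auto simp: lookup_update lookup_add lookup_single in_keys_iff when_def)
  then show ?case using assms(2) update by metis
qed

lemma free_act_mult: "free_act (f * g) q = free_act f (free_act g q)"
proof (induction f rule: free_alg_induct)
  case zero
  then show ?case by (simp add: free_act_0)
next
  case (add_single f u c)
  have "free_act (Poly_Mapping.single u c * g) q = free_act (Poly_Mapping.single u c) (free_act g q)"
  proof (induction g rule: free_alg_induct)
    case zero
    then show ?case by (simp add: free_act_0 free_act_arg_0)
  next
    case (add_single g v d)
    then show ?case
      by (simp add: distrib_left free_act_add free_act_arg_add mult_single free_act_single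
          plus_word_def weyl_act_append weyl_act_smult)
  qed
  with add_single show ?case
    by (simp add: distrib_right free_act_add)
qed

lemma free_act_1: "free_act 1 q = q"
  unfolding single_one[symmetric] by (simp add: free_act_single zero_word_def)

lemma one_notin_weyl_ideal: "1 \<notin> weyl_ideal"
proof
  assume one: "(1 :: 'a free_alg) \<in> weyl_ideal"
  let ?K = "{f :: 'a free_alg. \<forall>q. free_act f q = 0}"
  have "two_sided_ideal ?K"
    by (auto simp: two_sided_ideal_def free_act_0 free_act_add free_act_mult free_act_arg_0)
  moreover have "free_gen GY * free_gen GX - free_gen GX * free_gen GY - 1 \<in> ?K"
    by (auto simp: free_act_diff free_act_mult free_act_single free_act_1 pderiv_pCons)
  ultimately have "weyl_ideal \<subseteq> ?K"
    unfolding weyl_ideal_def by (intro hull_minimal) auto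
  with one have "free_act (1 :: 'a free_alg) 1 = 0"
    by blast
  then show False
    by (simp add: free_act_1)
qed


section \<open>The Weyl algebra\<close>

definition weyl_rel :: "'f::field free_alg \<Rightarrow> 'f free_alg \<Rightarrow> bool" where
  "weyl_rel a b \<longleftrightarrow> a - b \<in> weyl_ideal"

lemma equivp_weyl_rel: "equivp (weyl_rel :: 'f::field free_alg \<Rightarrow> _)"
proof (rule equivpI)
  show "reflp (weyl_rel :: 'f free_alg \<Rightarrow> _)"
    by (rule reflpI) (simp add: weyl_rel_def weyl_ideal_0)
  show "symp (weyl_rel :: 'f free_alg \<Rightarrow> _)"
    by (rule sympI) (auto simp: weyl_rel_def dest: weyl_ideal_uminus)
  show "transp (weyl_rel :: 'f free_alg \<Rightarrow> _)"
  proof (rule transpI)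
    fix a b c :: "'f free_alg"
    assume "weyl_rel a b" "weyl_rel b c"
    then have "(a - b) + (b - c) \<in> weyl_ideal"
      unfolding weyl_rel_def by (intro weyl_ideal_add)
    then show "weyl_rel a c"
      by (simp add: weyl_rel_def)
  qed
qed

quotient_type (overloaded) 'f weyl = "'f::field free_alg" / weyl_rel
  by (rule equivp_weyl_rel)

instantiation weyl :: (field) ring_1
begin

lift_definition zero_weyl :: "'a weyl" is 0 .

lift_definition one_weyl :: "'a weyl" is 1 .

lift_definition plus_weyl :: "'a weyl \<Rightarrow> 'a weyl \<Rightarrow> 'a weyl" is "(+)"
proof -
  fix a b c d :: "'a free_alg"
  assume "weyl_rel a b" "weyl_rel c d"
  then have "(a - b) + (c - d) \<in> weyl_ideal"
    unfolding weyl_rel_def by (intro weyl_ideal_add)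
  then show "weyl_rel (a + c) (b + d)"
    by (simp add: weyl_rel_def add_diff_add)
qed

lift_definition uminus_weyl :: "'a weyl \<Rightarrow> 'a weyl" is uminus
proof -
  fix a b :: "'a free_alg"
  assume "weyl_rel a b"
  then show "weyl_rel (- a) (- b)"
    unfolding weyl_rel_def using weyl_ideal_uminus[of "a - b"] by simp
qed

lift_definition minus_weyl :: "'a weyl \<Rightarrow> 'a weyl \<Rightarrow> 'a weyl" is "(-)"
proof -
  fix a b c d :: "'a free_alg"
  assume "weyl_rel a b" "weyl_rel c d"
  then have "(a - b) + - (c - d) \<in> weyl_ideal"
    unfolding weyl_rel_def by (intro weyl_ideal_add weyl_ideal_uminus)
  then show "weyl_rel (a - c) (b - d)"
    by (simp add: weyl_rel_def algebra_simps)
qed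

lift_definition times_weyl :: "'a weyl \<Rightarrow> 'a weyl \<Rightarrow> 'a weyl" is "(*)"
proof -
  fix a b c d :: "'a free_alg"
  assume "weyl_rel a b" "weyl_rel c d"
  then have "(a - b) * c + b * (c - d) \<in> weyl_ideal"
    unfolding weyl_rel_def by (intro weyl_ideal_add weyl_ideal_mult_left weyl_ideal_mult_right)
  then show "weyl_rel (a * c) (b * d)"
    by (simp add: weyl_rel_def algebra_simps)
qed

instance
proof
  show "(0 :: 'a weyl) \<noteq> 1"
    using one_notin_weyl_ideal[where 'a = 'a] weyl_ideal_uminus[of "- 1 :: 'a free_alg"]
    by transfer (auto simp: weyl_rel_def)
qed (transfer, simp add: weyl_rel_def weyl_ideal_0 algebra_simps)+

end

lift_definition weyl_x :: "'f::field weyl" is "free_gen GX" .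

lift_definition weyl_y :: "'f::field weyl" is "free_gen GY" .

lift_definition weyl_const :: "'f::field \<Rightarrow> 'f weyl" is "Poly_Mapping.single 0" .

lemma weyl_commutator: "weyl_y * weyl_x - weyl_x * weyl_y = (1 :: 'f::field weyl)"
proof transfer
  show "weyl_rel (free_gen GY * free_gen GX - free_gen GX * free_gen GY) (1 :: 'f free_alg)"
    unfolding weyl_rel_def weyl_ideal_def by (rule hull_inc) simp
qed

definition weyl_poly :: "'f::field poly \<Rightarrow> 'f weyl" where
  "weyl_poly q = (\<Sum>i\<le>Polynomial.degree q. weyl_const (coeff q i) * weyl_x ^ i)"

definition commutator :: "'r::ring \<Rightarrow> 'r \<Rightarrow> 'r" where
  "commutator u v = u * v - v * u"


section \<open>The subalgebras \<open>A\<^sub>h\<close>\<close>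

definition subalgebra :: "'f::field weyl set \<Rightarrow> bool" where
  "subalgebra B \<longleftrightarrow> range weyl_const \<subseteq> B \<and> (\<forall>a\<in>B. \<forall>b\<in>B. a + b \<in> B \<and> a * b \<in> B)"

definition y_hat :: "'f::field poly \<Rightarrow> 'f weyl" where
  "y_hat h = weyl_y * weyl_poly h"

definition A_sub :: "'f::field poly \<Rightarrow> 'f weyl set" where
  "A_sub h = subalgebra hull {weyl_x, y_hat h}"

definition center :: "'f::field weyl set \<Rightarrow> 'f weyl set" where
  "center B = {z \<in> B. \<forall>b\<in>B. z * b = b * z}"

definition normalizer :: "'f::field weyl set \<Rightarrow> 'f weyl set" where
  "normalizer B = {u. \<forall>b\<in>B. commutator u b \<in> B}"


section \<open>Derivations\<close>

text \<open>A map on a subalgebra \<open>B\<close> is represented by its extension by zero to the whole Weyl algebra,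
  so that equality, sums and scalar multiples of maps on \<open>B\<close> are those of functions.\<close>

definition restrict0 :: "'f::field weyl set \<Rightarrow> ('f weyl \<Rightarrow> 'f weyl) \<Rightarrow> 'f weyl \<Rightarrow> 'f weyl" where
  "restrict0 B d = (\<lambda>a. if a \<in> B then d a else 0)"

definition Der :: "'f::field weyl set \<Rightarrow> ('f weyl \<Rightarrow> 'f weyl) set" where
  "Der B = {d. d ` B \<subseteq> B \<and>
     (\<forall>a\<in>B. \<forall>b\<in>B. d (a + b) = d a + d b) \<and>
     (\<forall>c. \<forall>a\<in>B. d (weyl_const c * a) = weyl_const c * d a) \<and>
     (\<forall>a\<in>B. \<forall>b\<in>B. d (a * b) = d a * b + a * d b) \<and>
     (\<forall>a. a \<notin> B \<longrightarrow> d a = 0)}"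

text \<open>A derivation is determined by its values on generators, so each description below is
  satisfied by at most one map; both maps exist because the prescribed values respect the
  defining relation of the algebra.\<close>

definition D_der :: "'f::field poly \<Rightarrow> 'f poly \<Rightarrow> 'f weyl \<Rightarrow> 'f weyl" where
  "D_der h r = (THE d. d \<in> Der (A_sub h) \<and> d weyl_x = 0 \<and> d (y_hat h) = weyl_poly r)"

definition E_x :: "'f::field weyl \<Rightarrow> 'f weyl" where
  "E_x = (THE d. d \<in> Der UNIV \<and> d weyl_x = weyl_y ^ (CHAR('f) - 1) \<and> d weyl_y = 0)"

definition ad :: "'f::field weyl set \<Rightarrow> 'f weyl \<Rightarrow> 'f weyl \<Rightarrow> 'f weyl" where
  "ad B u = restrict0 B (commutator u)"

definition center_multiples ::
    "'f::field weyl set \<Rightarrow> ('f weyl \<Rightarrow> 'f weyl) \<Rightarrow> ('f weyl \<Rightarrow> 'f weyl) set" where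
  "center_multiples B d = {restrict0 B (\<lambda>a. z * d a) | z. z \<in> center B}"


section \<open>Internal direct sums\<close>

definition fun_scale :: "'f::field \<Rightarrow> ('a \<Rightarrow> 'f weyl) \<Rightarrow> 'a \<Rightarrow> 'f weyl" where
  "fun_scale c d = (\<lambda>a. weyl_const c * d a)"

lemma
  fixes c d :: "'f::field"
  shows weyl_const_add: "weyl_const (c + d) = (weyl_const c + weyl_const d :: 'f weyl)"
    and weyl_const_mult: "weyl_const (c * d) = (weyl_const c * weyl_const d :: 'f weyl)"
    and weyl_const_1: "weyl_const 1 = (1 :: 'f weyl)"
  by (transfer, simp add: weyl_rel_def weyl_ideal_0 single_add mult_single)+

lemma vector_space_fun_scale: "vector_space fun_scale"
  by unfold_locales
    (auto simp: fun_scale_def fun_eq_iff weyl_const_add weyl_const_mult weyl_const_1 algebra_simps)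

lemma vector_space_smult: "vector_space (smult :: 'f::field \<Rightarrow> 'f poly \<Rightarrow> 'f poly)"
  by unfold_locales (auto simp: smult_add_right smult_add_left)

text \<open>\<open>listset Ws\<close> consists of the lists with one entry from each member of \<open>Ws\<close>, in order;
  bijectivity of summation says that every element of \<open>V\<close> decomposes uniquely.\<close>

definition is_direct_sum ::
    "('f::field \<Rightarrow> 'v::ab_group_add \<Rightarrow> 'v) \<Rightarrow> 'v set \<Rightarrow> 'v set list \<Rightarrow> bool" where
  "is_direct_sum scale V Ws \<longleftrightarrow>
     (\<forall>W\<in>set Ws. module.subspace scale W) \<and> bij_betw sum_list (listset Ws) V"

end

theory Submission
  imports Defs "HOL-Library.Product_Plus"
begin

text \<open>Write \<open>R\<close> for the polynomials in \<open>x\<close>. Elements of the Weyl algebra are identified with their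
  symbols, polynomials in a commuting variable \<open>t\<close> over \<open>R\<close>, where \<open>f t\<^sup>j\<close> stands for \<open>f y\<^sup>j\<close>. Then
  \<open>[a, x]\<close> is \<open>da/dt\<close>, \<open>[y, a]\<close> is \<open>da/dx\<close>, and \<open>A\<^sub>h\<close> consists of the symbols whose
  \<open>t\<^sup>j\<close>-coefficient is divisible by \<open>h\<^sup>j\<close> (\<open>mem_A_sub_iff\<close>). In characteristic \<open>p\<close> a symbol is a
  \<open>t\<close>-derivative exactly when no exponent \<open>j \<equiv> -1\<close> modulo \<open>p\<close> occurs, and a polynomial in \<open>x\<close> is \<open>h\<close> times a
  derivative exactly when its exponents are at least \<open>m\<close> and none is \<open>\<equiv> m - 1\<close>. These two obstructions
  account for the outer derivations.

  Let \<open>d\<close> be a derivation of \<open>A\<^sub>h\<close>. The part of \<open>d x\<close> with exponents \<open>j \<equiv> -1\<close> has the form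
  \<open>g y\<^sup>p\<^sup>-\<^sup>1\<close>, and \<open>d (x\<^sup>p) = (p - 1)! g\<close>. Since \<open>d\<close> preserves the center, \<open>g\<close> is central
  (\<open>Der_x_decomposition\<close>); its coefficients are polynomials in \<open>x\<^sup>p\<close>, so the divisibility conditions
  defining \<open>A\<^sub>h\<close> make it a central multiple of the displayed power of \<open>x\<close> (\<open>center_divisible\<close>).
  Subtracting that multiple of \<open>E\<^sub>x\<close> leaves \<open>d x = [w, x]\<close>, and comparing coefficients in
  \<open>d (y h) = [w, y h] + c\<close>, where \<open>c\<close> commutes with \<open>x\<close>, shows that \<open>w\<close> normalizes \<open>A\<^sub>h\<close>
  (\<open>integral_in_normalizer\<close>). What remains sends \<open>x\<close> to \<open>0\<close> and \<open>y h\<close> to \<open>c\<close>. Splitting each coefficient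
  of \<open>c\<close> according to the exponents of \<open>x\<close> yields a central multiple of \<open>x\<^sup>r\<close> with \<open>r \<equiv> m - 1\<close>, an element
  of \<open>S\<close>, and \<open>h\<close> times a derivative, which is inner (\<open>centralizer_decomposition\<close>).
  The same bookkeeping of exponents gives uniqueness.\<close>

section \<open>Modules over the Weyl algebra\<close>

lemma weyl_const_0: "weyl_const 0 = (0 :: 'f::field weyl)"
  using weyl_const_add[of 0 "0::'f"] by simp

lemma weyl_const_comm: "weyl_const c * a = a * weyl_const (c :: 'f::field)"
proof transfer
  fix c :: 'f and a :: "'f free_alg"
  have "Poly_Mapping.single 0 c * a = a * Poly_Mapping.single 0 c"
    by (induction a rule: free_alg_induct)
      (simp_all add: distrib_left distrib_right mult_single mult.commute)
  then show "weyl_rel (Poly_Mapping.single 0 c * a) (a * Poly_Mapping.single 0 c)"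
    by (simp add: weyl_rel_def weyl_ideal_0)
qed

lemma weyl_induct [case_names const x y add mult]:
  assumes "\<And>c. P (weyl_const c)" "P weyl_x" "P weyl_y"
    "\<And>a b. P a \<Longrightarrow> P b \<Longrightarrow> P (a + b)" "\<And>a b. P a \<Longrightarrow> P b \<Longrightarrow> P (a * b)"
  shows "P (a :: 'f::field weyl)"
proof -
  have word: "P (abs_weyl (Poly_Mapping.single (Word w) c))" for w and c :: 'f
  proof (induction w)
    case Nil
    show ?case
      using assms(1)[of c] by (simp add: weyl_const.abs_eq zero_word_def)
  next
    case (Cons g w)
    have gen: "P (abs_weyl (free_gen g))"
      using assms(2,3) by (cases g) (simp_all add: weyl_x_def weyl_y_def)
    have "Poly_Mapping.single (Word (g # w)) c = free_gen g * Poly_Mapping.single (Word w) c"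
      by (simp add: mult_single plus_word_def)
    then show ?case
      using assms(5)[OF gen Cons] by (simp add: times_weyl.abs_eq)
  qed
  have "P (abs_weyl f)" for f
  proof (induction f rule: free_alg_induct)
    case zero
    show ?case
      using assms(1)[of 0] by (simp add: weyl_const_0 zero_weyl_def)
  next
    case (add_single f w c)
    then show ?case
      using assms(4)[OF add_single word[of "letters w" c]] by (simp add: plus_weyl.abs_eq)
  qed
  then show ?thesis
    by (metis Quotient_weyl Quotient_abs_rep)
qed

definition weyl_action ::
    "('f::field \<Rightarrow> 'm::ab_group_add \<Rightarrow> 'm) \<Rightarrow> ('m \<Rightarrow> 'm) \<Rightarrow> ('m \<Rightarrow> 'm) \<Rightarrow> ('f weyl \<Rightarrow> 'm \<Rightarrow> 'm) \<Rightarrow> bool" where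
  "weyl_action sc X Y act \<longleftrightarrow>
     (\<forall>a v w. act a (v + w) = act a v + act a w) \<and>
     (\<forall>a b v. act (a + b) v = act a v + act b v) \<and>
     (\<forall>a b v. act (a * b) v = act a (act b v)) \<and>
     (\<forall>c v. act (weyl_const c) v = sc c v) \<and> act weyl_x = X \<and> act weyl_y = Y"

text \<open>Words act by composing \<open>X\<close> and \<open>Y\<close>, which makes the module a module over the free
  algebra. The elements acting as zero form a two-sided ideal containing the defining relator,
  so the action descends to the Weyl algebra.\<close>

lemma weyl_action_exists:
  fixes sc :: "'f::field \<Rightarrow> 'm::ab_group_add \<Rightarrow> 'm"
  assumes X: "module_hom sc sc X" and Y: "module_hom sc sc Y"
    and rel: "\<And>v. Y (X v) = X (Y v) + v"
  shows "\<exists>act. weyl_action sc X Y act"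
proof -
  interpret X: module_hom sc sc X by (rule X)
  interpret Y: module_hom sc sc Y by (rule Y)
  define G where "G g = (case g of GX \<Rightarrow> X | GY \<Rightarrow> Y)" for g
  define W where "W w v = foldr G (letters w) v" for w v
  define F where "F f v = (\<Sum>w\<in>Poly_Mapping.keys f. sc (Poly_Mapping.lookup f w) (W w v))" for f v
  have G_add: "G g (v + w) = G g v + G g w" and G_sc: "G g (sc c v) = sc c (G g v)" for g v w c
    by (cases g; simp add: G_def X.add Y.add X.scale Y.scale)+
  have W_add: "W u (v + w) = W u v + W u w" for u v w
  proof -
    have "foldr G l (v + w) = foldr G l v + foldr G l w" for l
      by (induction l) (simp_all add: G_add)
    then show ?thesis by (simp add: W_def)
  qed
  have W_sc: "W u (sc c v) = sc c (W u v)" for u v c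
  proof -
    have "foldr G l (sc c v) = sc c (foldr G l v)" for l
      by (induction l) (simp_all add: G_sc)
    then show ?thesis by (simp add: W_def)
  qed
  have W_plus: "W (u + w) v = W u (W w v)" for u w v
    by (simp add: W_def plus_word_def)
  have F_superset: "F f v = (\<Sum>w\<in>B. sc (Poly_Mapping.lookup f w) (W w v))"
    if "finite B" "Poly_Mapping.keys f \<subseteq> B" for f v B
    unfolding F_def by (rule sum.mono_neutral_left) (use that in \<open>auto simp: in_keys_iff\<close>)
  have F_0: "F 0 v = 0" for v
    by (simp add: F_def)
  have F_single: "F (Poly_Mapping.single w c) v = sc c (W w v)" for w c v
    by (subst F_superset[of "{w}"]) auto
  have F_add: "F (f + g) v = F f v + F g v" for f g v
  proof -
    let ?B = "Poly_Mapping.keys f \<union> Poly_Mapping.keys g"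
    have "Poly_Mapping.keys (f + g) \<subseteq> ?B"
      by (rule Poly_Mapping.keys_add)
    then show ?thesis
      using F_superset[of ?B "f + g" v] F_superset[of ?B f v] F_superset[of ?B g v]
      by (simp add: lookup_add X.m1.scale_left_distrib sum.distrib)
  qed
  have F_diff: "F (f - g) v = F f v - F g v" for f g v
    using F_add[of "f - g" g v] by (simp add: algebra_simps)
  have F_arg_add: "F f (v + w) = F f v + F f w" for f v w
    by (simp add: F_def W_add X.m1.scale_right_distrib sum.distrib)
  have F_arg_0: "F f 0 = 0" for f
    using F_arg_add[of f 0 0] by simp
  have F_mult: "F (f * g) v = F f (F g v)" for f g v
  proof (induction f rule: free_alg_induct)
    case zero
    show ?case by (simp add: F_0)
  next
    case (add_single f u c)
    have "F (Poly_Mapping.single u c * g) v = F (Poly_Mapping.single u c) (F g v)"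
      by (induction g rule: free_alg_induct)
        (simp_all add: F_0 F_arg_0 distrib_left F_add F_arg_add mult_single F_single W_plus W_sc)
    with add_single show ?case
      by (simp add: distrib_right F_add)
  qed
  have F_1: "F 1 v = v" for v
    unfolding single_one[symmetric] by (simp add: F_single W_def zero_word_def)
  have F_ideal: "F f v = 0" if "f \<in> weyl_ideal" for f v
  proof -
    let ?K = "{f. \<forall>v. F f v = 0}"
    have "two_sided_ideal ?K"
      by (auto simp: two_sided_ideal_def F_0 F_add F_mult F_arg_0)
    moreover have "free_gen GY * free_gen GX - free_gen GX * free_gen GY - 1 \<in> ?K"
      by (auto simp: F_diff F_mult F_single F_1 W_def G_def rel)
    ultimately have "weyl_ideal \<subseteq> ?K"
      unfolding weyl_ideal_def by (intro hull_minimal) auto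
    with that show ?thesis by blast
  qed
  have F_rel: "F f v = F g v" if "weyl_rel f g" for f g v
    using F_ideal[of "f - g" v] that by (simp add: weyl_rel_def F_diff)
  define act where "act a = F (rep_weyl a)" for a
  have act_abs: "act (abs_weyl f) v = F f v" for f v
    unfolding act_def by (rule F_rel) (metis Quotient_weyl Quotient_rep_abs equivp_reflp equivp_weyl_rel)
  have surj: "\<exists>f. a = abs_weyl f" for a :: "'f weyl"
    by (metis Quotient_weyl Quotient_abs_rep)
  show ?thesis
    unfolding weyl_action_def
  proof (intro exI conjI allI)
    show "act a (v + w) = act a v + act a w" for a v w
      by (simp add: act_def F_arg_add)
    show "act (a + b) v = act a v + act b v" for a b v
      using surj[of a] surj[of b] by (auto simp: plus_weyl.abs_eq act_abs F_add)
    show "act (a * b) v = act a (act b v)" for a b v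
      using surj[of a] surj[of b] by (auto simp: times_weyl.abs_eq act_abs F_mult)
    show "act (weyl_const c) v = sc c v" for c v
      by (simp add: weyl_const.abs_eq act_abs F_single W_def zero_word_def)
    show "act weyl_x = X"
      by (simp add: weyl_x_def act_abs F_single W_def G_def fun_eq_iff)
    show "act weyl_y = Y"
      by (simp add: weyl_y_def act_abs F_single W_def G_def fun_eq_iff)
  qed
qed


section \<open>Polynomials in the Weyl algebra\<close>

lemma weyl_poly_superset:
  assumes "Polynomial.degree q \<le> N"
  shows "weyl_poly q = (\<Sum>i\<le>N. weyl_const (coeff q i) * weyl_x ^ i)"
  unfolding weyl_poly_def
  by (rule sum.mono_neutral_left) (use assms in \<open>auto simp: coeff_eq_0 weyl_const_0\<close>)

lemma weyl_poly_add: "weyl_poly (f + g) = weyl_poly f + weyl_poly g"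
proof -
  define N where "N = max (Polynomial.degree f) (Polynomial.degree g)"
  have "Polynomial.degree (f + g) \<le> N" "Polynomial.degree f \<le> N" "Polynomial.degree g \<le> N"
    by (auto simp: N_def degree_add_le_max)
  then show ?thesis
    by (simp add: weyl_poly_superset[of _ N] weyl_const_add distrib_right sum.distrib)
qed

lemma weyl_poly_pCons: "weyl_poly (pCons c f) = weyl_const c + weyl_x * weyl_poly f"
proof -
  define N where "N = Polynomial.degree f"
  have "weyl_poly (pCons c f) = (\<Sum>i\<le>Suc N. weyl_const (coeff (pCons c f) i) * weyl_x ^ i)"
    by (rule weyl_poly_superset) (simp add: N_def degree_pCons_le)
  also have "\<dots> = weyl_const c + (\<Sum>i\<le>N. weyl_const (coeff f i) * (weyl_x * weyl_x ^ i))"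
    by (subst sum.atMost_Suc_shift) simp
  also have "(\<Sum>i\<le>N. weyl_const (coeff f i) * (weyl_x * weyl_x ^ i)) = weyl_x * weyl_poly f"
    unfolding weyl_poly_superset[of f N, unfolded N_def, OF order_refl] N_def sum_distrib_left
    by (intro sum.cong refl) (metis weyl_const_comm mult.assoc)
  finally show ?thesis .
qed

lemma weyl_poly_0: "weyl_poly 0 = 0"
  by (simp add: weyl_poly_def weyl_const_0)

lemma weyl_poly_const: "weyl_poly [:c:] = weyl_const c"
  by (simp add: weyl_poly_pCons weyl_poly_0)

lemma weyl_poly_1: "weyl_poly 1 = 1"
  using weyl_poly_const[of 1] by (simp add: weyl_const_1 one_pCons)

lemma weyl_poly_smult: "weyl_poly (smult c f) = weyl_const c * weyl_poly f"
proof (induction f)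
  case 0
  show ?case by (simp add: weyl_poly_0)
next
  case (pCons d f)
  then show ?case
    by (simp add: weyl_poly_pCons weyl_const_mult distrib_left) (metis weyl_const_comm mult.assoc)
qed

lemma weyl_poly_mult: "weyl_poly (f * g) = weyl_poly f * weyl_poly g"
proof (induction f)
  case 0
  show ?case by (simp add: weyl_poly_0)
next
  case (pCons c f)
  then show ?case
    by (simp add: weyl_poly_add weyl_poly_smult weyl_poly_pCons weyl_const_0 distrib_right mult.assoc)
qed

lemma weyl_poly_comm: "weyl_poly f * weyl_poly g = weyl_poly g * weyl_poly f"
  by (metis weyl_poly_mult mult.commute)

lemma weyl_poly_x: "weyl_poly [:0, 1:] = weyl_x"
  by (simp add: weyl_poly_pCons weyl_poly_0 weyl_const_0 weyl_const_1)

lemma weyl_poly_monom: "weyl_poly (monom 1 n) = weyl_x ^ n"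
  by (induction n) (simp_all add: weyl_poly_1 monom_Suc weyl_poly_pCons weyl_const_0)

lemma weyl_x_poly_comm: "weyl_x * weyl_poly f = weyl_poly f * weyl_x"
  using weyl_poly_comm[of "[:0, 1:]" f] by (simp add: weyl_poly_x)

lemma weyl_y_poly: "weyl_y * weyl_poly f = weyl_poly f * weyl_y + weyl_poly (pderiv f)"
proof (induction f)
  case 0
  show ?case by (simp add: weyl_poly_0)
next
  case (pCons c f)
  have yx: "weyl_y * (weyl_x * b) = weyl_x * (weyl_y * b) + b" for b :: "'a weyl"
    using arg_cong[OF weyl_commutator, of "\<lambda>u. u * b"] by (simp add: algebra_simps)
  show ?case
    by (simp add: weyl_poly_pCons pderiv_pCons distrib_left distrib_right yx pCons weyl_poly_add
        weyl_const_0 weyl_const_comm mult.assoc)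
qed


section \<open>Symbols\<close>

text \<open>In characteristic \<open>p\<close> the usual action on polynomials in \<open>x\<close> is not faithful: \<open>y\<^sup>p\<close> acts as
  zero. Adjoining a second variable \<open>t\<close> and letting \<open>y\<close> act as \<open>d/dx + t\<close> repairs this, because
  \<open>f y\<^sup>j\<close> then takes \<open>1\<close> to \<open>f t\<^sup>j\<close>. Elements of \<open>'f poly poly\<close> are polynomials in \<open>t\<close> with
  coefficients in \<open>F[x]\<close>.\<close>

definition symbol_act :: "'f::field weyl \<Rightarrow> 'f poly poly \<Rightarrow> 'f poly poly" where
  "symbol_act = (SOME act. weyl_action (\<lambda>c. smult [:c:]) (smult [:0, 1:])
     (\<lambda>q. map_poly pderiv q + pCons 0 q) act)"

definition symbol :: "'f::field weyl \<Rightarrow> 'f poly poly" where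
  "symbol a = symbol_act a 1"

lemma map_pderiv_add: "map_poly pderiv (q + r) = map_poly pderiv q + map_poly pderiv (r :: 'f::field poly poly)"
  by (simp add: poly_eq_iff coeff_map_poly pderiv_add)

lemma map_pderiv_smult:
  "map_poly pderiv (smult f q) = smult f (map_poly pderiv q) + smult (pderiv f) (q :: 'f::field poly poly)"
  by (simp add: poly_eq_iff coeff_map_poly pderiv_mult algebra_simps)

lemma symbol_action:
  "weyl_action (\<lambda>c. smult [:c:]) (smult [:0, 1:]) (\<lambda>q. map_poly pderiv q + pCons 0 q)
     (symbol_act :: 'f::field weyl \<Rightarrow> _)"
proof -
  let ?X = "smult [:0, 1:] :: 'f poly poly \<Rightarrow> _" and ?Y = "\<lambda>q :: 'f poly poly. map_poly pderiv q + pCons 0 q"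
  have mod: "module (\<lambda>c :: 'f. smult [:c:] :: 'f poly poly \<Rightarrow> _)"
    by unfold_locales (simp_all add: poly_eq_iff[where 'a = "'f poly"] smult_add_right smult_add_left mult.commute)
  have X: "module_hom (\<lambda>c :: 'f. smult [:c:]) (\<lambda>c. smult [:c:]) ?X"
    by (intro module_hom.intro mod module_hom_axioms.intro) (simp_all add: smult_add_right)
  have Y: "module_hom (\<lambda>c :: 'f. smult [:c:]) (\<lambda>c. smult [:c:]) ?Y"
    by (intro module_hom.intro mod module_hom_axioms.intro)
      (simp_all add: map_pderiv_add map_pderiv_smult smult_add_right pderiv_pCons)
  have "?Y (?X v) = ?X (?Y v) + v" for v
    by (simp add: map_pderiv_smult pderiv_pCons smult_add_right one_pCons[symmetric])
  then show ?thesis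
    unfolding symbol_act_def by (rule someI_ex[OF weyl_action_exists[OF X Y]])
qed

lemma
  shows symbol_act_add: "symbol_act (a + b) q = symbol_act a q + symbol_act b q"
    and symbol_act_mult: "symbol_act (a * b) q = symbol_act a (symbol_act b q)"
    and symbol_act_const: "symbol_act (weyl_const c) q = smult [:c:] q"
    and symbol_act_x: "symbol_act weyl_x q = smult [:0, 1:] q"
    and symbol_act_y: "symbol_act weyl_y q = map_poly pderiv q + pCons 0 q"
  by (simp_all add: symbol_action[unfolded weyl_action_def])

text \<open>Multiplication by \<open>t\<close> commutes with the action; on symbols it is right multiplication by \<open>y\<close>.\<close>

lemma symbol_act_pCons_0: "symbol_act a (pCons 0 q) = pCons 0 (symbol_act a q)"
  by (induction a arbitrary: q rule: weyl_induct)
    (simp_all add: symbol_act_add symbol_act_mult symbol_act_const symbol_act_x symbol_act_y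
      map_poly_pCons)

text \<open>The operator \<open>x + d/dt\<close> commutes with \<open>x\<close>, and with \<open>d/dx + t\<close> because the two brackets
  \<open>[d/dx, x] = 1\<close> and \<open>[t, d/dt] = -1\<close> cancel; hence it commutes with the whole action. On
  symbols it is right multiplication by \<open>x\<close>.\<close>

lemma symbol_act_pderiv:
  "symbol_act a (smult [:0, 1:] q + pderiv q) =
     smult [:0, 1:] (symbol_act a q) + pderiv (symbol_act a q)"
proof (induction a arbitrary: q rule: weyl_induct)
  case y
  have "pderiv (map_poly pderiv q) = map_poly pderiv (pderiv q)"
    by (simp add: poly_eq_iff coeff_map_poly coeff_pderiv pderiv_mult pderiv_of_nat[of "Suc _", simplified])
  then show ?case
    by (simp add: symbol_act_y map_pderiv_add map_pderiv_smult pderiv_add pderiv_pCons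
        smult_add_right one_pCons[symmetric] flip: of_nat_Suc)
qed (simp_all add: symbol_act_add symbol_act_mult symbol_act_const symbol_act_x
      smult_add_right pderiv_add pderiv_smult mult.commute)

lemma symbol_act_poly: "symbol_act (weyl_poly f) q = smult f q"
proof (induction f)
  case 0
  show ?case using symbol_act_const[of 0 q] by (simp add: weyl_poly_0 weyl_const_0)
next
  case (pCons c f)
  have "smult (pCons c f) q = smult ([:c:] + [:0, 1:] * f) q" by simp
  also have "\<dots> = smult [:c:] q + smult [:0, 1:] (smult f q)"
    by (simp only: smult_add_left smult_smult)
  finally show ?case
    by (simp add: weyl_poly_pCons symbol_act_add symbol_act_mult symbol_act_const symbol_act_x pCons)
qed

lemma symbol_add: "symbol (a + b) = symbol a + symbol b"
  by (simp add: symbol_def symbol_act_add)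

lemma symbol_poly_mult: "symbol (weyl_poly f * a) = smult f (symbol a)"
  by (simp add: symbol_def symbol_act_mult symbol_act_poly)

lemma symbol_mult_y: "symbol (a * weyl_y) = pCons 0 (symbol a)"
  by (simp add: symbol_def symbol_act_mult symbol_act_y map_poly_pCons one_pCons
      flip: symbol_act_pCons_0)

lemma symbol_0: "symbol 0 = 0"
  using symbol_add[of 0 0] unfolding add_0_left by (metis add_cancel_right_right)

lemma symbol_diff: "symbol (a - b) = symbol a - symbol b"
  using symbol_add[of "a - b" b] by (simp add: algebra_simps)

lemma symbol_sum: "symbol (sum f B) = (\<Sum>i\<in>B. symbol (f i))"
  by (induction B rule: infinite_finite_induct) (simp_all add: symbol_0 symbol_add)

lemma symbol_1: "symbol 1 = 1"
  unfolding symbol_def weyl_poly_1[symmetric] by (simp only: symbol_act_poly smult_1_left)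

lemma symbol_y_mult: "symbol (weyl_y * a) = map_poly pderiv (symbol a) + pCons 0 (symbol a)"
  by (simp add: symbol_def symbol_act_mult symbol_act_y)

lemma symbol_x_mult: "symbol (weyl_x * a) = smult [:0, 1:] (symbol a)"
  by (simp add: symbol_def symbol_act_mult symbol_act_x)

text \<open>This and the next lemma turn all later commutator computations into differentiation of
  symbols with respect to \<open>t\<close> and \<open>x\<close>.\<close>

lemma symbol_commutator_x: "symbol (commutator a weyl_x) = pderiv (symbol a)"
  using symbol_act_pderiv[of a 1]
  by (simp add: commutator_def symbol_def symbol_diff[unfolded symbol_def] symbol_act_mult symbol_act_x)

lemma symbol_commutator_y: "symbol (commutator weyl_y a) = map_poly pderiv (symbol a)"
  by (simp add: commutator_def symbol_diff symbol_mult_y symbol_y_mult)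

text \<open>Horner evaluation with \<open>y\<close> for \<open>t\<close> on the right of the coefficients. Being inverse to
  \<^const>\<open>symbol\<close>, it shows that the monomials \<open>x\<^sup>i y\<^sup>j\<close> form a basis of the Weyl algebra.\<close>

definition of_symbol :: "'f::field poly poly \<Rightarrow> 'f weyl" where
  "of_symbol q = fold_coeffs (\<lambda>f a. weyl_poly f + a * weyl_y) q 0"

lemma of_symbol_0: "of_symbol 0 = 0"
  by (simp add: of_symbol_def)

lemma of_symbol_pCons: "of_symbol (pCons f q) = weyl_poly f + of_symbol q * weyl_y"
  by (cases "f = 0 \<and> q = 0") (auto simp: of_symbol_def weyl_poly_0)

lemma symbol_of_symbol: "symbol (of_symbol q) = q"
proof (induction q)
  case 0
  show ?case by (simp add: of_symbol_0 symbol_0)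
next
  case (pCons f q)
  then show ?case
    using symbol_poly_mult[of f 1] by (simp add: of_symbol_pCons symbol_add symbol_mult_y symbol_1)
qed

lemma of_symbol_add: "of_symbol (q + r) = of_symbol q + of_symbol r"
  by (induction q r rule: poly_induct2)
    (simp_all add: of_symbol_0 of_symbol_pCons weyl_poly_add algebra_simps)

lemma of_symbol_smult: "of_symbol (smult f q) = weyl_poly f * of_symbol q"
  by (induction q) (simp_all add: of_symbol_0 of_symbol_pCons weyl_poly_mult distrib_left mult.assoc)

lemma of_symbol_y: "of_symbol (map_poly pderiv q + pCons 0 q) = weyl_y * of_symbol q"
proof (induction q)
  case 0
  show ?case by (simp add: of_symbol_0)
next
  case (pCons f q)
  have "of_symbol (map_poly pderiv q) + of_symbol q * weyl_y = weyl_y * of_symbol q"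
    using pCons(2) by (simp add: of_symbol_add of_symbol_pCons weyl_poly_0)
  then have "of_symbol (map_poly pderiv q) * weyl_y + of_symbol q * weyl_y * weyl_y
      = weyl_y * of_symbol q * weyl_y"
    by (metis distrib_right)
  then show ?case
    by (simp add: map_poly_pCons of_symbol_add of_symbol_pCons weyl_poly_0 weyl_y_poly algebra_simps)
qed

lemma of_symbol_act: "of_symbol (symbol_act a q) = a * of_symbol q"
proof (induction a arbitrary: q rule: weyl_induct)
  case (mult a b)
  then show ?case by (simp add: symbol_act_mult mult.assoc)
next
  case y
  show ?case by (simp only: symbol_act_y of_symbol_y)
qed (simp_all add: symbol_act_const symbol_act_x symbol_act_add
      of_symbol_smult of_symbol_add weyl_poly_const weyl_poly_x distrib_right)

lemma of_symbol_symbol: "of_symbol (symbol a) = a"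
proof -
  have "of_symbol 1 = (1 :: 'a weyl)"
    by (simp add: one_pCons of_symbol_pCons of_symbol_0 weyl_poly_1[unfolded one_pCons])
  then show ?thesis by (simp add: symbol_def of_symbol_act)
qed

lemma symbol_inject: "symbol a = symbol b \<longleftrightarrow> a = b"
  by (metis of_symbol_symbol)

section \<open>The subalgebra in terms of symbols\<close>

lemma coeff_symbol_y_mult:
  "coeff (symbol (weyl_y * a)) j =
     pderiv (coeff (symbol a) j) + (case j of 0 \<Rightarrow> 0 | Suc i \<Rightarrow> coeff (symbol a) i)"
  by (simp add: symbol_y_mult coeff_map_poly coeff_pCons)

lemma coeff_symbol_commutator_x:
  "coeff (symbol (commutator a weyl_x)) j = smult (of_nat (Suc j)) (coeff (symbol a) (Suc j))"
  by (simp add: symbol_commutator_x coeff_pderiv of_nat_poly)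

lemma coeff_symbol_mult_x:
  "coeff (symbol (a * weyl_x)) j =
     [:0, 1:] * coeff (symbol a) j + smult (of_nat (Suc j)) (coeff (symbol a) (Suc j))"
proof -
  have "a * weyl_x = weyl_x * a + commutator a weyl_x"
    by (simp add: commutator_def)
  then show ?thesis
    by (simp add: symbol_add symbol_x_mult coeff_symbol_commutator_x)
qed

lemma symbol_y_power: "symbol (weyl_y ^ n) = monom 1 n"
  by (induction n) (simp_all add: symbol_1 symbol_mult_y power_Suc2 monom_Suc del: power_Suc)

lemma symbol_poly: "symbol (weyl_poly f) = [:f:]"
  using symbol_poly_mult[of f 1] by (simp add: symbol_1)

lemma mult_pderiv_power:
  fixes f :: "'a::{comm_ring_1,semiring_no_zero_divisors} poly"
  shows "f * pderiv (f ^ i) = smult (of_nat i) (f ^ i * pderiv f)"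
  by (cases i) (simp_all add: pderiv_power_Suc mult_ac del: of_nat_Suc power_Suc, simp add: mult_ac)

lemma power_dvd_pderiv:
  fixes f :: "'a::field poly"
  assumes "f ^ Suc i dvd q"
  shows "f ^ i dvd pderiv q"
proof -
  obtain r where "q = f ^ Suc i * r" using assms by (auto simp: dvd_def)
  then have "pderiv q = f ^ i * (f * pderiv r + smult (of_nat (Suc i)) (pderiv f) * r)"
    by (simp add: pderiv_mult pderiv_power_Suc algebra_simps del: of_nat_Suc power_Suc) (simp add: mult_ac)
  then show ?thesis by simp
qed

lemma power_dvd_mult_pderiv:
  fixes f :: "'a::field poly"
  assumes "f ^ i dvd q"
  shows "f ^ i dvd f * pderiv q"
proof -
  obtain r where "q = f ^ i * r" using assms by (auto simp: dvd_def)
  then have "f * pderiv q = f ^ i * (f * pderiv r) + f * pderiv (f ^ i) * r"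
    by (simp add: pderiv_mult algebra_simps)
  then show ?thesis
    by (simp add: mult_pderiv_power mult.assoc dvd_smult)
qed

lemma subalgebra_A_sub: "subalgebra (A_sub h)"
  unfolding A_sub_def by (rule hull_in) (auto simp: subalgebra_def)

lemma
  shows weyl_x_in_A_sub: "weyl_x \<in> A_sub h"
    and y_hat_in_A_sub: "y_hat h \<in> A_sub h"
    and weyl_const_in_A_sub: "weyl_const c \<in> A_sub h"
    and A_sub_add: "a \<in> A_sub h \<Longrightarrow> b \<in> A_sub h \<Longrightarrow> a + b \<in> A_sub h"
    and A_sub_mult: "a \<in> A_sub h \<Longrightarrow> b \<in> A_sub h \<Longrightarrow> a * b \<in> A_sub h"
  using subalgebra_A_sub[of h] by (auto simp: subalgebra_def A_sub_def intro: hull_inc)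

lemma A_sub_induct [consumes 1, case_names const x y_hat add mult]:
  assumes "a \<in> A_sub h"
    and "\<And>c. P (weyl_const c)" "P weyl_x" "P (y_hat h)"
    and "\<And>a b. a \<in> A_sub h \<Longrightarrow> b \<in> A_sub h \<Longrightarrow> P a \<Longrightarrow> P b \<Longrightarrow> P (a + b)"
    and "\<And>a b. a \<in> A_sub h \<Longrightarrow> b \<in> A_sub h \<Longrightarrow> P a \<Longrightarrow> P b \<Longrightarrow> P (a * b)"
  shows "P a"
proof -
  have "A_sub h \<subseteq> {a \<in> A_sub h. P a}"
    using assms(2-) unfolding A_sub_def
    by (intro hull_minimal; fold A_sub_def)
      (auto simp: subalgebra_def weyl_x_in_A_sub y_hat_in_A_sub weyl_const_in_A_sub A_sub_add A_sub_mult)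
  then show ?thesis using assms(1) by auto
qed

lemma weyl_const_uminus: "weyl_const (- c) = - weyl_const c"
  using weyl_const_add[of c "- c"] by (simp add: weyl_const_0 eq_neg_iff_add_eq_0 add.commute)

lemma A_sub_uminus: "a \<in> A_sub h \<Longrightarrow> - a \<in> A_sub h"
  using A_sub_mult[OF weyl_const_in_A_sub[of "- 1"], of a h]
  by (simp add: weyl_const_uminus weyl_const_1)

lemma A_sub_diff: "a \<in> A_sub h \<Longrightarrow> b \<in> A_sub h \<Longrightarrow> a - b \<in> A_sub h"
  using A_sub_add[of a h "- b"] by (simp add: A_sub_uminus)

lemma A_sub_0: "0 \<in> A_sub h"
  using weyl_const_in_A_sub[of 0] by (simp add: weyl_const_0)

lemma A_sub_1: "1 \<in> A_sub h"
  using weyl_const_in_A_sub[of 1] by (simp add: weyl_const_1)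

lemma weyl_poly_in_A_sub: "weyl_poly f \<in> A_sub h"
  by (induction f)
    (simp_all add: weyl_poly_0 A_sub_0 weyl_poly_pCons A_sub_add A_sub_mult weyl_x_in_A_sub
      weyl_const_in_A_sub)

lemma y_hat_eq: "y_hat h = weyl_poly h * weyl_y + weyl_poly (pderiv h)"
  by (simp add: y_hat_def weyl_y_poly)

text \<open>Moving \<open>h y\<close> past \<open>h\<^sup>i\<close> gives \<open>h\<^sup>i\<^sup>+\<^sup>1 y\<^sup>i\<^sup>+\<^sup>1\<close> up to the multiple \<open>i h'\<close> of \<open>h\<^sup>i y\<^sup>i\<close>.\<close>

lemma power_y_in_A_sub: "weyl_poly (h ^ i) * weyl_y ^ i \<in> A_sub h"
proof (induction i)
  case 0
  show ?case by (simp add: weyl_poly_1 A_sub_1)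
next
  case (Suc i)
  let ?b = "weyl_poly (h ^ i) * weyl_y ^ i"
  have "weyl_poly (h ^ Suc i) * weyl_y ^ Suc i =
      (y_hat h - weyl_poly (pderiv h)) * ?b - weyl_poly (smult (of_nat i) (pderiv h)) * ?b"
  proof -
    have "(y_hat h - weyl_poly (pderiv h)) * ?b = weyl_poly h * (weyl_y * weyl_poly (h ^ i)) * weyl_y ^ i"
      by (simp add: y_hat_eq mult.assoc)
    also have "\<dots> = weyl_poly (h ^ Suc i) * weyl_y ^ Suc i + weyl_poly (h * pderiv (h ^ i)) * weyl_y ^ i"
      by (simp add: weyl_y_poly weyl_poly_mult algebra_simps)
    also have "weyl_poly (h * pderiv (h ^ i)) * weyl_y ^ i = weyl_poly (smult (of_nat i) (pderiv h)) * ?b"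
      unfolding mult_pderiv_power
      by (simp add: mult.assoc[symmetric] weyl_poly_mult[symmetric] mult.commute)
    finally show ?thesis by simp
  qed
  then show ?case
    using Suc by (simp add: A_sub_diff A_sub_mult y_hat_in_A_sub weyl_poly_in_A_sub del: power_Suc)
qed

text \<open>The algebra is the free left module over the polynomials in \<open>x\<close> on the elements \<open>h\<^sup>j y\<^sup>j\<close>.
  For the inclusion into that module it is enough that the generators preserve the module
  under left multiplication, since the module contains \<open>1\<close>.\<close>

theorem mem_A_sub_iff: "a \<in> A_sub h \<longleftrightarrow> (\<forall>j. h ^ j dvd coeff (symbol a) j)"
proof
  let ?P = "{a. \<forall>j. h ^ j dvd coeff (symbol a) j}"
  have poly: "weyl_poly f * b \<in> ?P" if "b \<in> ?P" for f b
    using that by (simp add: symbol_poly_mult)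
  assume "a \<in> A_sub h"
  then have "\<forall>b\<in>?P. a * b \<in> ?P"
  proof (induction rule: A_sub_induct)
    case (const c)
    show ?case using poly[of _ "[:c:]"] by (simp add: weyl_poly_const)
  next
    case x
    show ?case using poly[of _ "[:0, 1:]"] by (simp add: weyl_poly_x)
  next
    case y_hat
    have "h ^ j dvd h * coeff (symbol (weyl_y * b)) j" if "b \<in> ?P" for b j
      using that power_dvd_mult_pderiv[of h j "coeff (symbol b) j"]
      by (auto simp: coeff_symbol_y_mult distrib_left split: nat.split)
    then show ?case
      by (simp add: y_hat_eq distrib_right symbol_add symbol_poly_mult mult.assoc)
  next
    case (add a b)
    then show ?case by (simp add: distrib_right symbol_add)
  next
    case (mult a b)
    then show ?case by (simp add: mult.assoc)
  qed
  moreover have "1 \<in> ?P" by (auto simp: symbol_1 one_pCons coeff_pCons split: nat.split)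
  ultimately show "\<forall>j. h ^ j dvd coeff (symbol a) j" by fastforce
next
  assume a: "\<forall>j. h ^ j dvd coeff (symbol a) j"
  have "of_symbol q * weyl_y ^ i \<in> A_sub h" if "\<forall>j. h ^ (i + j) dvd coeff q j" for q i
    using that
  proof (induction q arbitrary: i)
    case 0
    show ?case by (simp add: of_symbol_0 A_sub_0)
  next
    case (pCons f q)
    have "h ^ (Suc i + j) dvd coeff q j" for j
      using pCons(3)[rule_format, of "Suc j"] by simp
    then have "of_symbol q * weyl_y ^ Suc i \<in> A_sub h"
      using pCons(2)[of "Suc i"] by simp
    moreover obtain g where "f = g * h ^ i"
      using pCons(3)[rule_format, of 0] by (auto simp: dvd_def mult.commute)
    then have "weyl_poly f * weyl_y ^ i \<in> A_sub h"
      using A_sub_mult[OF weyl_poly_in_A_sub power_y_in_A_sub, of g h i]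
      by (simp add: weyl_poly_mult mult.assoc)
    ultimately show ?case
      by (simp add: of_symbol_pCons distrib_right A_sub_add mult.assoc)
  qed
  from this[of 0 "symbol a"] a show "a \<in> A_sub h"
    by (simp add: of_symbol_symbol)
qed

section \<open>Derivations\<close>

text \<open>The Weyl algebra is itself the case \<open>h = 1\<close>, so facts about derivations of \<open>A\<^sub>h\<close> apply to it.\<close>

lemma UNIV_eq_A_sub: "UNIV = A_sub 1"
  by (auto simp: mem_A_sub_iff)

lemma y_hat_1: "y_hat 1 = weyl_y"
  by (simp add: y_hat_def weyl_poly_1)

lemma
  assumes "d \<in> Der B"
  shows Der_closed: "a \<in> B \<Longrightarrow> d a \<in> B"
    and Der_add: "a \<in> B \<Longrightarrow> b \<in> B \<Longrightarrow> d (a + b) = d a + d b"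
    and Der_scale: "a \<in> B \<Longrightarrow> d (weyl_const c * a) = weyl_const c * d a"
    and Der_mult: "a \<in> B \<Longrightarrow> b \<in> B \<Longrightarrow> d (a * b) = d a * b + a * d b"
    and Der_outside: "a \<notin> B \<Longrightarrow> d a = 0"
  using assms by (auto simp: Der_def)

lemma Der_one:
  assumes "d \<in> Der (A_sub h)"
  shows "d 1 = 0"
  using Der_mult[OF assms A_sub_1 A_sub_1] by simp

lemma Der_const:
  assumes "d \<in> Der (A_sub h)"
  shows "d (weyl_const c) = 0"
  using Der_scale[OF assms A_sub_1, of c] by (simp add: Der_one[OF assms])

lemma Der_UNIV_const: "d \<in> Der UNIV \<Longrightarrow> d (weyl_const c) = 0"
  using Der_const[of d 1 c] by (simp add: UNIV_eq_A_sub)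

lemma Der_poly_eq_0:
  assumes "d \<in> Der (A_sub h)" "d weyl_x = 0"
  shows "d (weyl_poly f) = 0"
proof (induction f)
  case 0
  show ?case using Der_const[OF assms(1), of 0] by (simp add: weyl_poly_0 weyl_const_0)
next
  case (pCons c f)
  then show ?case
    by (simp add: weyl_poly_pCons Der_add[OF assms(1)] Der_mult[OF assms(1)] Der_const[OF assms(1)]
        assms(2) weyl_const_in_A_sub A_sub_mult weyl_x_in_A_sub weyl_poly_in_A_sub)
qed

lemma Der_diff:
  assumes "d \<in> Der (A_sub h)" "a \<in> A_sub h" "b \<in> A_sub h"
  shows "d (a - b) = d a - d b"
  using Der_add[OF assms(1) A_sub_diff[OF assms(2,3)] assms(3)] by (simp add: algebra_simps)

lemma Der_eqI:
  assumes "d \<in> Der (A_sub h)" "d' \<in> Der (A_sub h)"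
    and "d weyl_x = d' weyl_x" "d (y_hat h) = d' (y_hat h)"
  shows "d = d'"
proof
  fix a
  show "d a = d' a"
  proof (cases "a \<in> A_sub h")
    case True
    then show ?thesis
      by (induction rule: A_sub_induct)
        (simp_all add: assms Der_const[OF assms(1)] Der_const[OF assms(2)] Der_add[OF assms(1)]
          Der_add[OF assms(2)] Der_mult[OF assms(1)] Der_mult[OF assms(2)])
  qed (simp add: Der_outside[OF assms(1)] Der_outside[OF assms(2)])
qed

lemma Der_UNIV_eqI:
  assumes "d \<in> Der UNIV" "d' \<in> Der UNIV" "d weyl_x = d' weyl_x" "d weyl_y = d' weyl_y"
  shows "d = d'"
  using assms Der_eqI[of d 1 d'] by (simp add: UNIV_eq_A_sub y_hat_1)

lemma weyl_const_left_comm: "a * (weyl_const c * b) = weyl_const c * (a * b)"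
  by (metis mult.assoc weyl_const_comm)

lemma commutator_in_Der_UNIV: "commutator u \<in> Der UNIV"
proof -
  have "commutator u (weyl_const c * a) = weyl_const c * commutator u a" for c a
    by (simp add: commutator_def right_diff_distrib mult.assoc weyl_const_left_comm)
  then show ?thesis
    by (simp add: Der_def) (simp add: commutator_def algebra_simps)
qed

lemma Der_UNIV_maps_A_sub:
  assumes \<delta>: "\<delta> \<in> Der UNIV" and "\<delta> weyl_x \<in> A_sub h" "\<delta> (y_hat h) \<in> A_sub h"
    and "a \<in> A_sub h"
  shows "\<delta> a \<in> A_sub h"
  using assms(4)
proof (induction rule: A_sub_induct)
  case (const c)
  then show ?case using Der_const[of \<delta> 1 c] \<delta> by (simp add: UNIV_eq_A_sub A_sub_0)
qed (use assms in \<open>simp_all add: Der_add[OF \<delta>] Der_mult[OF \<delta>] A_sub_add A_sub_mult\<close>)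

lemma restrict_in_Der:
  assumes \<delta>: "\<delta> \<in> Der UNIV" and "\<delta> weyl_x \<in> A_sub h" "\<delta> (y_hat h) \<in> A_sub h"
  shows "restrict0 (A_sub h) \<delta> \<in> Der (A_sub h)"
  using Der_UNIV_maps_A_sub[OF assms]
  by (auto simp: Der_def restrict0_def Der_add[OF \<delta>] Der_mult[OF \<delta>] Der_UNIV_const[OF \<delta>]
      A_sub_add A_sub_mult weyl_const_in_A_sub)

text \<open>Inner maps are derivations, so it suffices to test them on the generators.\<close>

lemma normalizer_A_sub_iff:
  "u \<in> normalizer (A_sub h) \<longleftrightarrow>
     commutator u weyl_x \<in> A_sub h \<and> commutator u (y_hat h) \<in> A_sub h"
  using Der_UNIV_maps_A_sub[OF commutator_in_Der_UNIV, of u h]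
  by (auto simp: normalizer_def weyl_x_in_A_sub y_hat_in_A_sub)

lemma ad_in_Der: "u \<in> normalizer (A_sub h) \<Longrightarrow> ad (A_sub h) u \<in> Der (A_sub h)"
  unfolding ad_def by (rule restrict_in_Der) (auto simp: commutator_in_Der_UNIV normalizer_A_sub_iff)

lemma zero_in_Der: "0 \<in> Der (A_sub h)"
  by (auto simp: Der_def A_sub_0)

lemma add_in_Der:
  assumes "d \<in> Der (A_sub h)" "d' \<in> Der (A_sub h)"
  shows "d + d' \<in> Der (A_sub h)"
  using assms unfolding Der_def
  by (auto simp: A_sub_add algebra_simps image_subset_iff)

lemma center_mult_in_Der:
  assumes "z \<in> center (A_sub h)" and d: "d \<in> Der (A_sub h)"
  shows "restrict0 (A_sub h) (\<lambda>a. z * d a) \<in> Der (A_sub h)"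
proof -
  have z: "z \<in> A_sub h" "\<And>b. b \<in> A_sub h \<Longrightarrow> z * b = b * z"
    using assms(1) by (auto simp: center_def)
  have "z * (weyl_const c * b) = weyl_const c * (z * b)" for c b
    by (metis mult.assoc weyl_const_comm)
  moreover have "z * (a * d b) = a * (z * d b)" if "a \<in> A_sub h" for a b
    by (metis mult.assoc z(2) that)
  ultimately show ?thesis
    using z(1) Der_closed[OF d]
    by (auto simp: Der_def restrict0_def Der_add[OF d] Der_mult[OF d] Der_const[OF d]
        A_sub_add A_sub_mult weyl_const_in_A_sub distrib_left mult.assoc)
qed

text \<open>A map \<open>\<delta>\<close> is a derivation exactly when \<open>a \<mapsto> (a, \<delta> a; 0, a)\<close> is a homomorphism into
  \<open>2 \<times> 2\<close> upper triangular matrices. Such a homomorphism is an action on pairs, and the hypothesis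
  is the defining relation for the matrices prescribed for \<open>x\<close> and \<open>y\<close>.\<close>

lemma weyl_derivation_exists:
  assumes rel: "commutator v weyl_x + commutator weyl_y u = 0"
  shows "\<exists>\<delta> \<in> Der UNIV. \<delta> weyl_x = u \<and> \<delta> weyl_y = v"
proof -
  let ?sc = "\<lambda>(c :: 'a) (b, b'). (weyl_const c * b, weyl_const c * b')"
  let ?X = "\<lambda>(b, b'). (weyl_x * b + u * b', weyl_x * b')"
  let ?Y = "\<lambda>(b, b'). (weyl_y * b + v * b', weyl_y * b')"
  have mod: "module ?sc"
    by unfold_locales (auto simp: distrib_left distrib_right weyl_const_add weyl_const_mult
        weyl_const_1 mult.assoc)
  have hom: "module_hom ?sc ?sc (\<lambda>(b, b'). (s * b + t * b', s * b'))" for s t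
    by (intro module_hom.intro mod module_hom_axioms.intro)
      (auto simp: distrib_left weyl_const_left_comm)
  have "?Y (?X q) = ?X (?Y q) + q" for q
  proof -
    have yx: "weyl_y * (weyl_x * b) = weyl_x * (weyl_y * b) + b" for b :: "'a weyl"
      using arg_cong[OF weyl_commutator, of "\<lambda>u. u * b"] by (simp add: algebra_simps)
    have "(v * weyl_x - weyl_x * v + (weyl_y * u - u * weyl_y)) * b = 0" for b
      using rel by (simp add: commutator_def)
    then show ?thesis
      by (cases q) (simp add: algebra_simps yx)
  qed
  then obtain act where "weyl_action ?sc ?X ?Y act"
    using weyl_action_exists[OF hom[of weyl_x u] hom[of weyl_y v]] by blast
  note act = this[unfolded weyl_action_def]
  define \<delta> where "\<delta> a = fst (act a (0, 1))" for a
  have act_eq: "act a (b, b') = (a * b + \<delta> a * b', a * b')" for a b b'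
  proof (induction a arbitrary: b b' rule: weyl_induct)
    case (add a1 a2)
    have "act (a1 + a2) (b, b') = act a1 (b, b') + act a2 (b, b')" "\<delta> (a1 + a2) = \<delta> a1 + \<delta> a2"
      by (simp_all add: \<delta>_def act)
    then show ?case by (simp add: add distrib_left distrib_right)
  next
    case (mult a1 a2)
    have "act (a1 * a2) q = act a1 (act a2 q)" for q
      by (simp add: act)
    moreover from this have "\<delta> (a1 * a2) = a1 * \<delta> a2 + \<delta> a1 * a2"
      by (simp add: \<delta>_def[of "a1 * a2"] mult)
    ultimately show ?case by (simp add: mult distrib_left distrib_right mult.assoc add.assoc)
  qed (simp_all add: act \<delta>_def)
  have "\<delta> (a + b) = \<delta> a + \<delta> b" for a b
    by (simp add: \<delta>_def act)
  moreover have "\<delta> (a * b) = \<delta> a * b + a * \<delta> b" for a b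
  proof -
    have "act (a * b) (0, 1) = act a (act b (0, 1))" by (simp add: act)
    then show ?thesis
      unfolding act_eq by (simp add: add.commute)
  qed
  moreover have "\<delta> (weyl_const c) = 0" for c
    by (simp add: \<delta>_def act)
  ultimately have "\<delta> \<in> Der UNIV"
    by (simp add: Der_def)
  moreover have "\<delta> weyl_x = u" "\<delta> weyl_y = v"
    by (simp_all add: \<delta>_def act)
  ultimately show ?thesis by blast
qed

lemma central_if_commutes_generators:
  assumes "c * weyl_x = weyl_x * c" "c * weyl_y = weyl_y * c"
  shows "c * a = a * c"
proof (induction a rule: weyl_induct)
  case (mult a b)
  then show ?case by (metis mult.assoc)
qed (simp_all add: assms weyl_const_comm algebra_simps)

lemma central_poly:
  assumes "pderiv f = 0"
  shows "weyl_poly f * a = a * weyl_poly f"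
  by (rule central_if_commutes_generators) (simp_all add: weyl_x_poly_comm weyl_y_poly assms weyl_poly_0)

lemma weyl_poly_mult_cancel:
  assumes "f \<noteq> 0"
  shows "weyl_poly f * a = weyl_poly f * b \<longleftrightarrow> a = b"
  using assms smult_eq_0_iff[of f "symbol (a - b)"] symbol_inject[of "a - b" 0]
  by (auto simp: symbol_0 simp flip: symbol_poly_mult) (metis right_diff_distrib right_minus_eq symbol_0)

lemma pderiv_power_char:
  fixes f :: "'f::field poly"
  shows "pderiv (f ^ CHAR('f)) = 0"
proof (cases "CHAR('f)")
  case (Suc k)
  then have "of_nat (Suc k) = (0 :: 'f)"
    by (metis of_nat_CHAR)
  then show ?thesis
    by (simp only: Suc pderiv_power_Suc) simp
qed simp

text \<open>On fractions the derivation would be \<open>x \<mapsto> 0\<close>, \<open>y \<mapsto> r/h\<close>. Multiplying by the central element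
  \<open>h\<^sup>p\<close> clears the denominator and gives a derivation \<open>\<delta>\<close> of the Weyl algebra. It sends the
  generators of \<open>A\<^sub>h\<close> into the bimodule \<open>h\<^sup>p A\<^sub>h\<close>, hence all of \<open>A\<^sub>h\<close>, and the factor can be
  cancelled again.\<close>

lemma D_der_exists:
  fixes h r :: "'f::field poly"
  assumes "h \<noteq> 0" "CHAR('f) > 0"
  shows "\<exists>d \<in> Der (A_sub h). d weyl_x = 0 \<and> d (y_hat h) = weyl_poly r"
proof -
  let ?H = "weyl_poly (h ^ CHAR('f))"
  have H: "?H * a = a * ?H" for a
    by (rule central_poly) (rule pderiv_power_char)
  have "commutator (weyl_poly (h ^ (CHAR('f) - 1) * r)) weyl_x + commutator weyl_y 0 = 0"
    by (simp add: commutator_def weyl_x_poly_comm)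
  then obtain \<delta> where \<delta>: "\<delta> \<in> Der UNIV" "\<delta> weyl_x = 0"
    "\<delta> weyl_y = weyl_poly (h ^ (CHAR('f) - 1) * r)"
    using weyl_derivation_exists by blast
  have \<delta>_poly: "\<delta> (weyl_poly f) = 0" for f
    using Der_poly_eq_0[of \<delta> 1] \<delta>(1,2) by (simp add: UNIV_eq_A_sub)
  have \<delta>_y_hat: "\<delta> (y_hat h) = ?H * weyl_poly r"
  proof -
    have "\<delta> (y_hat h) = weyl_poly (h ^ (CHAR('f) - 1) * r * h)"
      by (simp add: y_hat_def Der_mult[OF \<delta>(1)] \<delta>(3) \<delta>_poly weyl_poly_mult)
    also have "h ^ (CHAR('f) - 1) * r * h = h ^ CHAR('f) * r"
      using assms(2) by (cases "CHAR('f)") auto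
    finally show ?thesis by (simp add: weyl_poly_mult)
  qed
  have "\<exists>b \<in> A_sub h. \<delta> a = ?H * b" if "a \<in> A_sub h" for a
    using that
  proof (induction rule: A_sub_induct)
    case (const c)
    then show ?case using \<delta>_poly[of "[:c:]"] by (auto simp: weyl_poly_const intro: bexI[of _ 0] A_sub_0)
  next
    case x
    then show ?case using \<delta>(2) by (auto intro: bexI[of _ 0] A_sub_0)
  next
    case y_hat
    then show ?case using \<delta>_y_hat weyl_poly_in_A_sub by blast
  next
    case (add a b)
    then show ?case by (metis Der_add[OF \<delta>(1)] A_sub_add distrib_left UNIV_I)
  next
    case (mult a b)
    then obtain a' b' where "a' \<in> A_sub h" "b' \<in> A_sub h" "\<delta> a = ?H * a'" "\<delta> b = ?H * b'"
      by blast
    moreover from this have "\<delta> (a * b) = ?H * (a' * b + a * b')"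
      using H[of a] by (simp add: Der_mult[OF \<delta>(1)] distrib_left mult.assoc[symmetric])
    ultimately show ?case using mult(1,2) by (metis A_sub_add A_sub_mult)
  qed
  then obtain d where d: "\<And>a. a \<in> A_sub h \<Longrightarrow> d a \<in> A_sub h \<and> ?H * d a = \<delta> a"
    by metis
  have cancel: "a = b" if "?H * a = ?H * b" for a b
    using assms(1) that by (simp add: weyl_poly_mult_cancel)
  have "restrict0 (A_sub h) d \<in> Der (A_sub h)"
  proof -
    have "d (a + b) = d a + d b" if "a \<in> A_sub h" "b \<in> A_sub h" for a b
      by (rule cancel) (use that d[of a] d[of b] d[OF A_sub_add[OF that]] in
          \<open>simp add: Der_add[OF \<delta>(1)] distrib_left\<close>)
    moreover have "d (a * b) = d a * b + a * d b" if "a \<in> A_sub h" "b \<in> A_sub h" for a b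
    proof (rule cancel)
      have "?H * d (a * b) = ?H * d a * b + a * (?H * d b)"
        using that d[of a] d[of b] d[OF A_sub_mult[OF that]] by (simp add: Der_mult[OF \<delta>(1)])
      then show "?H * d (a * b) = ?H * (d a * b + a * d b)"
        using H[of a] by (simp add: distrib_left mult.assoc[symmetric])
    qed
    moreover have "d (weyl_const c * a) = weyl_const c * d a" if "a \<in> A_sub h" for a c
      by (rule cancel) (use that d[of a] d[OF A_sub_mult[OF weyl_const_in_A_sub[of c] that]] in
          \<open>simp add: Der_scale[OF \<delta>(1)] weyl_const_left_comm\<close>)
    ultimately show ?thesis
      using d by (auto simp: Der_def restrict0_def A_sub_add A_sub_mult[of "weyl_const _"]
          A_sub_mult weyl_const_in_A_sub)
  qed
  moreover have "d weyl_x = 0" "d (y_hat h) = weyl_poly r"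
    by (rule cancel; use d[OF weyl_x_in_A_sub] d[OF y_hat_in_A_sub] \<delta>(2) \<delta>_y_hat in simp)+
  ultimately show ?thesis
    by (intro bexI[of _ "restrict0 (A_sub h) d"])
      (auto simp: restrict0_def weyl_x_in_A_sub y_hat_in_A_sub)
qed

lemma
  fixes h r :: "'f::field poly"
  assumes "h \<noteq> 0" "CHAR('f) > 0"
  shows D_der_in_Der: "D_der h r \<in> Der (A_sub h)"
    and D_der_x: "D_der h r weyl_x = 0"
    and D_der_y_hat: "D_der h r (y_hat h) = weyl_poly r"
proof -
  have "\<exists>!d. d \<in> Der (A_sub h) \<and> d weyl_x = 0 \<and> d (y_hat h) = weyl_poly r"
    using D_der_exists[OF assms, of r] Der_eqI[of _ h] by metis
  from theI'[OF this] show "D_der h r \<in> Der (A_sub h)" "D_der h r weyl_x = 0"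
    "D_der h r (y_hat h) = weyl_poly r"
    by (simp_all add: D_der_def)
qed

lemma
  shows E_x_in_Der: "E_x \<in> Der (UNIV :: 'f::field weyl set)"
    and E_x_x: "E_x weyl_x = (weyl_y :: 'f weyl) ^ (CHAR('f) - 1)"
    and E_x_y: "E_x weyl_y = (0 :: 'f weyl)"
proof -
  have "commutator 0 weyl_x + commutator weyl_y (weyl_y ^ (CHAR('f) - 1)) = (0 :: 'f weyl)"
    by (simp add: commutator_def power_commutes)
  then have "\<exists>!d. d \<in> Der UNIV \<and> d weyl_x = (weyl_y :: 'f weyl) ^ (CHAR('f) - 1) \<and> d weyl_y = 0"
    using weyl_derivation_exists Der_UNIV_eqI by metis
  from theI'[OF this] show "E_x \<in> Der (UNIV :: 'f weyl set)"
    "E_x weyl_x = (weyl_y :: 'f weyl) ^ (CHAR('f) - 1)" "E_x weyl_y = (0 :: 'f weyl)"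
    by (simp_all add: E_x_def)
qed

section \<open>Centralizers in positive characteristic\<close>

lemma poly_with_coeffs_exists:
  fixes f :: "nat \<Rightarrow> 'a::zero"
  assumes "\<And>j. j > N \<Longrightarrow> f j = 0"
  shows "\<exists>q. \<forall>j. coeff q j = f j"
  using coeff_Abs_poly[of N f] assms by metis

lemma weyl_with_coeffs_exists:
  fixes f :: "nat \<Rightarrow> 'f::field poly"
  assumes "\<And>j. j > N \<Longrightarrow> f j = 0"
  shows "\<exists>a. \<forall>j. coeff (symbol a) j = f j"
  using poly_with_coeffs_exists[of N f] assms symbol_of_symbol by metis

lemma commutator_poly_eq_0:
  assumes "commutator a weyl_x = 0"
  shows "commutator a (weyl_poly f) = 0"
  using Der_poly_eq_0[of "commutator a" 1] assms commutator_in_Der_UNIV[of a]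
  by (simp add: UNIV_eq_A_sub)

lemma commutator_y_hat_of_centralizer:
  assumes "commutator w weyl_x = 0"
  shows "commutator w (y_hat h) = - (weyl_poly h * commutator weyl_y w)"
  using commutator_poly_eq_0[OF assms, of h] commutator_poly_eq_0[OF assms, of "pderiv h"]
  by (simp add: y_hat_eq commutator_def algebra_simps) (metis mult.assoc)

lemma coeff_symbol_mult_y_power:
  "coeff (symbol (a * weyl_y ^ n)) j = (if j < n then 0 else coeff (symbol a) (j - n))"
proof -
  have "symbol (a * weyl_y ^ n) = monom 1 n * symbol a"
    by (induction n) (simp_all add: power_Suc2 symbol_mult_y monom_Suc flip: mult.assoc del: power_Suc)
  then show ?thesis by (simp add: coeff_monom_mult)
qed

lemma Der_x_power:
  assumes "d \<in> Der (A_sub h)"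
  shows "d (weyl_x ^ n) = (\<Sum>a<n. weyl_x ^ a * d weyl_x * weyl_x ^ (n - Suc a))"
proof (induction n)
  case 0
  show ?case by (simp add: Der_one[OF assms])
next
  case (Suc n)
  have x: "weyl_x ^ n \<in> A_sub h" for n
    using weyl_poly_in_A_sub[of "monom 1 n"] by (simp add: weyl_poly_monom)
  have "d (weyl_x ^ Suc n) = d (weyl_x ^ n) * weyl_x + weyl_x ^ n * d weyl_x"
    unfolding power_Suc2 by (rule Der_mult[OF assms x weyl_x_in_A_sub])
  also have "d (weyl_x ^ n) * weyl_x = (\<Sum>a<n. weyl_x ^ a * d weyl_x * weyl_x ^ (Suc n - Suc a))"
    unfolding Suc sum_distrib_right
    by (intro sum.cong refl) (simp add: mult.assoc Suc_diff_Suc flip: power_Suc2)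
  finally show ?case by simp
qed

locale weyl_char_p =
  fixes p :: nat and h :: "'f::field poly"
  assumes char: "CHAR('f) = p" and p_pos: "p > 0" and h_nonzero: "h \<noteq> 0"
begin

lemma prime_p: "prime p"
  using prime_CHAR_semidom[where 'a = 'f] char p_pos by simp

lemma of_nat_eq_0: "of_nat n = (0 :: 'f) \<longleftrightarrow> p dvd n"
  by (simp add: of_nat_eq_0_iff_char_dvd char)

lemma pderiv_eq_0_iff: "pderiv f = 0 \<longleftrightarrow> (\<forall>i. \<not> p dvd i \<longrightarrow> coeff (f :: 'f poly) i = 0)"
proof
  assume "pderiv f = 0"
  then have "of_nat (Suc i) * coeff f (Suc i) = 0" for i
    by (metis coeff_0 coeff_pderiv)
  then show "\<forall>i. \<not> p dvd i \<longrightarrow> coeff f i = 0"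
    by (metis of_nat_eq_0 dvd_0_right mult_eq_0_iff not0_implies_Suc)
next
  assume "\<forall>i. \<not> p dvd i \<longrightarrow> coeff f i = 0"
  then show "pderiv f = 0"
    by (simp add: poly_eq_iff coeff_pderiv del: of_nat_Suc) (metis of_nat_eq_0)
qed

lemma commutes_x_iff:
  fixes a :: "'f weyl"
  shows "commutator a weyl_x = 0 \<longleftrightarrow> (\<forall>j. \<not> p dvd j \<longrightarrow> coeff (symbol a) j = 0)"
proof -
  have "commutator a weyl_x = 0 \<longleftrightarrow> (\<forall>i. smult (of_nat (Suc i)) (coeff (symbol a) (Suc i)) = 0)"
    by (simp only: symbol_inject[symmetric] symbol_0 poly_eq_iff coeff_symbol_commutator_x coeff_0)
  also have "\<dots> \<longleftrightarrow> (\<forall>j. \<not> p dvd j \<longrightarrow> coeff (symbol a) j = 0)"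
    by (metis of_nat_eq_0 dvd_0_right not0_implies_Suc smult_eq_0_iff)
  finally show ?thesis .
qed

lemma commutes_y_iff:
  fixes a :: "'f weyl"
  shows "commutator weyl_y a = 0 \<longleftrightarrow> (\<forall>j. pderiv (coeff (symbol a) j) = 0)"
  by (simp add: symbol_commutator_y poly_eq_iff[where 'a = "'f poly"] coeff_map_poly symbol_0
      flip: symbol_inject)

lemma x_power_central: "p dvd e \<Longrightarrow> weyl_x ^ e * a = a * (weyl_x ^ e :: 'f weyl)"
  using central_poly[of "monom 1 e" a] by (simp add: weyl_poly_monom pderiv_monom of_nat_eq_0)

text \<open>An element commuting with \<open>x\<close> satisfies \<open>[z, y h] = - h [y, z]\<close>, and \<open>h\<close> can be cancelled:
  the center of \<open>A\<^sub>h\<close> is central even in the Weyl algebra.\<close>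

lemma mem_center_iff:
  "z \<in> center (A_sub h) \<longleftrightarrow>
     z \<in> A_sub h \<and> (\<forall>a. z * a = a * z)"
proof
  assume "z \<in> center (A_sub h)"
  then have z: "z \<in> A_sub h" "commutator z weyl_x = 0" "commutator z (y_hat h) = 0"
    by (auto simp: center_def commutator_def weyl_x_in_A_sub y_hat_in_A_sub)
  then have "weyl_poly h * commutator weyl_y z = weyl_poly h * 0"
    by (simp add: commutator_y_hat_of_centralizer)
  then have "commutator weyl_y z = 0"
    using h_nonzero weyl_poly_mult_cancel by blast
  with z show "z \<in> A_sub h \<and> (\<forall>a. z * a = a * z)"
    using central_if_commutes_generators[of z] by (simp add: commutator_def)
qed (auto simp: center_def)

lemma mem_center_iff_coeffs:
  "z \<in> center (A_sub h) \<longleftrightarrow>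
     z \<in> A_sub h \<and> (\<forall>j. \<not> p dvd j \<longrightarrow> coeff (symbol z) j = 0) \<and>
     (\<forall>j. pderiv (coeff (symbol z) j) = 0)"
  unfolding mem_center_iff commutes_x_iff[symmetric] commutes_y_iff[symmetric] commutator_def
  using central_if_commutes_generators[of z] by auto

lemma Der_center:
  assumes d: "d \<in> Der (A_sub h)" and "z \<in> center (A_sub h)"
  shows "d z \<in> center (A_sub h)"
proof -
  have z: "z \<in> A_sub h" "\<And>b. b \<in> A_sub h \<Longrightarrow> z * b = b * z"
    using assms(2) by (auto simp: center_def)
  have "d z * b = b * d z" if "b \<in> A_sub h" for b
  proof -
    have "d z * b + z * d b = d b * z + b * d z"
      using z that Der_mult[OF d, of z b] Der_mult[OF d, of b z] by simp
    with z(2)[OF Der_closed[OF d that]] show ?thesis by simp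
  qed
  then show ?thesis
    using Der_closed[OF d z(1)] by (simp add: center_def)
qed

text \<open>This is the value at \<open>x\<^sup>p\<close> of any derivation that sends \<open>x\<close> to \<open>u\<close>.\<close>

definition conjugate_sum :: "'f weyl \<Rightarrow> 'f weyl" where
  "conjugate_sum u = (\<Sum>a<p. weyl_x ^ a * u * weyl_x ^ (p - Suc a))"

lemma conjugate_sum_add: "conjugate_sum (u + v) = conjugate_sum u + conjugate_sum v"
  by (simp add: conjugate_sum_def distrib_left distrib_right sum.distrib)

text \<open>The inner derivation given by \<open>w\<close> kills the central element \<open>x\<^sup>p\<close>.\<close>

lemma conjugate_sum_commutator: "conjugate_sum (commutator w weyl_x) = 0"
proof -
  have "conjugate_sum (commutator w weyl_x) = commutator w (weyl_x ^ p)"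
    unfolding conjugate_sum_def using Der_x_power[of "commutator w" 1 p] commutator_in_Der_UNIV[of w]
    by (simp add: UNIV_eq_A_sub)
  also have "\<dots> = 0"
    using x_power_central[of p w] by (simp add: commutator_def)
  finally show ?thesis .
qed

lemma conjugate_sum_centralizer_mult:
  assumes "commutator g weyl_x = 0"
  shows "conjugate_sum (g * u) = g * conjugate_sum u"
proof -
  have "g * weyl_x ^ a = weyl_x ^ a * g" for a
    using commutator_poly_eq_0[OF assms, of "monom 1 a"] by (simp add: commutator_def weyl_poly_monom)
  then show ?thesis
    unfolding conjugate_sum_def sum_distrib_left by (intro sum.cong refl) (simp flip: mult.assoc)
qed

text \<open>The sum is the value of \<^const>\<open>E_x\<close> at the central element \<open>x\<^sup>p\<close>, so it commutes with \<open>x\<close>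
  and its symbol involves only powers of \<open>t\<^sup>p\<close>. The degree in \<open>t\<close> is below \<open>p\<close>, so only the constant
  coefficient is left. The summand with exponents \<open>a\<close> and \<open>b = p - 1 - a\<close> contributes
  \<open>x\<^sup>a (d/dx)\<^sup>p\<^sup>-\<^sup>1 x\<^sup>b\<close> to it, which vanishes unless \<open>a = 0\<close>.\<close>

lemma conjugate_sum_y_power: "conjugate_sum (weyl_y ^ (p - 1)) = weyl_const (of_nat (fact (p - 1)))"
proof -
  let ?P = "conjugate_sum (weyl_y ^ (p - 1))"
  have sum: "E_x (weyl_x ^ p) = ?P"
    unfolding conjugate_sum_def using Der_x_power[of "E_x :: 'f weyl \<Rightarrow> _" 1 p] E_x_in_Der[where 'f = 'f]
    by (simp add: UNIV_eq_A_sub E_x_x char)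
  have "E_x (weyl_x ^ p * weyl_x) = E_x (weyl_x * (weyl_x :: 'f weyl) ^ p)"
    by (simp add: power_commutes)
  then have "commutator ?P weyl_x = 0"
    using x_power_central[of p "E_x weyl_x"] sum
    by (simp add: Der_mult[OF E_x_in_Der] commutator_def algebra_simps)
  then have high: "coeff (symbol ?P) j = 0" if "0 < j" "j < p" for j
    using that unfolding commutes_x_iff by (metis nat_dvd_not_less)
  have deg: "coeff (symbol (weyl_x ^ a * weyl_y ^ (p - 1) * weyl_x ^ b :: 'f weyl)) j = 0" if "p \<le> j" for a b j
    using that
  proof (induction b arbitrary: j)
    case 0
    then show ?case
      using symbol_poly_mult[of "monom 1 a :: 'f poly" "weyl_y ^ (p - 1)"] p_pos
      by (simp add: weyl_poly_monom symbol_y_power)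
  next
    case (Suc b)
    then show ?case
      by (simp add: power_Suc2 mult.assoc[symmetric] coeff_symbol_mult_x del: power_Suc)
  qed
  have "coeff (symbol ?P) j = 0" if "0 < j" for j
    using that high deg[of j] by (cases "p \<le> j") (auto simp: conjugate_sum_def symbol_sum coeff_sum)
  moreover have "coeff (symbol ?P) 0 = [:of_nat (fact (p - 1)):]"
  proof -
    have y: "coeff (symbol (weyl_y ^ n * weyl_poly f)) 0 = (pderiv ^^ n) f" for n and f :: "'f poly"
      by (induction n) (simp_all add: symbol_poly mult.assoc coeff_symbol_y_mult)
    have "coeff (symbol (weyl_x ^ a * weyl_y ^ (p - 1) * weyl_x ^ (p - Suc a) :: 'f weyl)) 0
        = monom 1 a * (pderiv ^^ (p - 1)) (monom 1 (p - Suc a) :: 'f poly)" for a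
      using symbol_poly_mult[of "monom 1 a :: 'f poly" "weyl_y ^ (p - 1) * weyl_poly (monom 1 (p - Suc a))"]
      by (simp add: weyl_poly_monom mult.assoc flip: y)
    moreover have "(pderiv ^^ (p - 1)) (monom 1 (p - Suc a)) = (0 :: 'f poly)" if "a < p" "a \<noteq> 0" for a
      using that by (auto simp: poly_eq_iff coeff_higher_pderiv)
    ultimately have "coeff (symbol ?P) 0 =
        (\<Sum>a<p. if a = 0 then (pderiv ^^ (p - 1)) (monom 1 (p - 1)) else 0)"
      unfolding conjugate_sum_def symbol_sum coeff_sum by (intro sum.cong refl) auto
    also have "\<dots> = (pderiv ^^ (p - 1)) (monom 1 (p - 1))"
      using p_pos by simp
    also have "\<dots> = [:of_nat (fact (p - 1)):]"
    proof (rule poly_eqI)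
      have "pochhammer (of_nat (Suc 0)) (p - 1) = (of_nat (fact (p - 1)) :: 'f)"
        by (simp only: pochhammer_of_nat pochhammer_fact) simp
      then show "coeff ((pderiv ^^ (p - 1)) (monom 1 (p - 1))) k = coeff [:of_nat (fact (p - 1)) :: 'f:] k" for k
        by (cases k) (simp_all add: coeff_higher_pderiv)
    qed
    finally show ?thesis .
  qed
  ultimately have "symbol ?P = [:[:of_nat (fact (p - 1)):]:]"
    by (auto simp: poly_eq_iff[where 'a = "'f poly"] coeff_pCons split: nat.split)
  then show ?thesis
    by (simp add: symbol_poly flip: weyl_poly_const symbol_inject)
qed

lemma fact_nonzero: "of_nat (fact (p - 1)) \<noteq> (0 :: 'f)"
  using prime_p p_pos by (simp add: of_nat_eq_0 prime_dvd_fact_iff del: of_nat_fact)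

end

section \<open>The value of a derivation at x\<close>

context weyl_char_p
begin

text \<open>Commutators with \<open>x\<close> are the elements whose symbol is a \<open>t\<close>-derivative; this is the case
  exactly when the exponents congruent to \<open>-1\<close> modulo \<open>p\<close> are absent. The remaining part of \<open>d x\<close> is
  \<open>g y\<^sup>p\<^sup>-\<^sup>1\<close> with \<open>g\<close> commuting with \<open>x\<close>. That \<open>g\<close> is central comes from the value
  of \<open>d\<close> at \<open>x\<^sup>p\<close>: derivations preserve the center, and \<open>d (x\<^sup>p) = (p - 1)! g\<close>.

  The integral \<open>w\<close> is normalized to have no exponents divisible by \<open>p\<close>, which is what makes it
  normalize \<open>A\<^sub>h\<close> later on.\<close>

lemma Der_x_decomposition:
  assumes d: "d \<in> Der (A_sub h)"
  obtains g w where "g \<in> center (A_sub h)" "d weyl_x = g * weyl_y ^ (p - 1) + commutator w weyl_x"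
    "\<And>j. p dvd j \<Longrightarrow> coeff (symbol w) j = 0"
    "\<And>j. p dvd j \<Longrightarrow> coeff (symbol g) j = coeff (symbol (d weyl_x)) (j + (p - 1))"
proof -
  let ?u = "coeff (symbol (d weyl_x))"
  define N where "N = Polynomial.degree (symbol (d weyl_x))"
  have u_high: "?u j = 0" if "j > N" for j
    using that by (simp add: N_def coeff_eq_0)
  obtain g where g: "\<And>j. coeff (symbol g) j = (if p dvd j then ?u (j + (p - 1)) else 0)"
    using weyl_with_coeffs_exists[of N "\<lambda>j. if p dvd j then ?u (j + (p - 1)) else 0"] u_high
    by fastforce
  obtain w where w: "\<And>j. coeff (symbol w) j =
      (if p dvd j then 0 else smult (inverse (of_nat j)) (?u (j - 1)))"
    using weyl_with_coeffs_exists[of "Suc N" "\<lambda>j. if p dvd j then 0 else smult (inverse (of_nat j)) (?u (j - 1))"]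
      u_high by fastforce
  have u: "d weyl_x = g * weyl_y ^ (p - 1) + commutator w weyl_x"
    unfolding symbol_inject[symmetric]
  proof (rule poly_eqI)
    fix j
    show "?u j = coeff (symbol (g * weyl_y ^ (p - 1) + commutator w weyl_x)) j"
    proof (cases "p dvd Suc j")
      case True
      then have j: "p - 1 \<le> j" by (auto dest: dvd_imp_le)
      then have "Suc j = (j - (p - 1)) + p" using p_pos by simp
      with True have "p dvd j - (p - 1)" by (metis dvd_add_left_iff dvd_refl)
      with True j show ?thesis
        by (simp add: symbol_add coeff_symbol_mult_y_power coeff_symbol_commutator_x g w)
    next
      case False
      have "of_nat (Suc j) \<noteq> (0 :: 'f)" unfolding of_nat_eq_0 by (rule False)
      moreover have "\<not> p dvd j - (p - 1)" if "p - 1 \<le> j"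
      proof -
        have "Suc j = (j - (p - 1)) + p" using that p_pos by simp
        with False show ?thesis by (metis dvd_add_left_iff dvd_refl)
      qed
      ultimately show ?thesis
        using False by (auto simp: symbol_add coeff_symbol_mult_y_power coeff_symbol_commutator_x g w
            simp del: of_nat_Suc)
    qed
  qed
  have gx: "commutator g weyl_x = 0"
    by (simp add: commutes_x_iff g)
  have "d (weyl_x ^ p) = conjugate_sum (d weyl_x)"
    by (simp add: Der_x_power[OF d] conjugate_sum_def)
  also have "\<dots> = g * weyl_const (of_nat (fact (p - 1)))"
    by (simp only: u conjugate_sum_add conjugate_sum_commutator conjugate_sum_centralizer_mult[OF gx]
        conjugate_sum_y_power add_0_right)
  finally have dxp: "d (weyl_x ^ p) = weyl_const (of_nat (fact (p - 1))) * g"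
    by (simp only: weyl_const_comm)
  let ?c = "inverse (of_nat (fact (p - 1)) :: 'f)"
  have "weyl_x ^ p \<in> center (A_sub h)"
    unfolding mem_center_iff
    using x_power_central[of p] weyl_poly_in_A_sub[of "monom 1 p" h] by (simp add: weyl_poly_monom)
  from Der_center[OF d this] have "d (weyl_x ^ p) \<in> center (A_sub h)" .
  then have "weyl_const ?c * d (weyl_x ^ p) \<in> center (A_sub h)"
    unfolding mem_center_iff
    by (metis A_sub_mult weyl_const_in_A_sub mult.assoc weyl_const_left_comm)
  also have "weyl_const ?c * d (weyl_x ^ p) = weyl_const (?c * of_nat (fact (p - 1))) * g"
    by (simp only: dxp weyl_const_mult mult.assoc)
  also have "\<dots> = g"
    using fact_nonzero by (simp add: weyl_const_1 del: of_nat_fact)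
  finally have "g \<in> center (A_sub h)" .
  then show thesis
    using that u w g by simp
qed

end


section \<open>Derivations modulo higher powers of h\<close>

text \<open>Multiplying an element of this set by \<open>y\<close> on either side stays in \<open>A\<^sub>h\<close>, so it collects the
  error terms that can be neglected when \<open>y\<close> occurs as an additional factor.\<close>

definition A_sub_shift :: "'f::field poly \<Rightarrow> 'f weyl set" where
  "A_sub_shift h = {a. \<forall>j. h ^ Suc j dvd coeff (symbol a) j}"

lemma A_sub_shift_subset: "q \<in> A_sub_shift h \<Longrightarrow> q \<in> A_sub h"
  unfolding A_sub_shift_def mem_A_sub_iff using dvd_mult_right by fastforce

lemma A_sub_shift_add: "q \<in> A_sub_shift h \<Longrightarrow> r \<in> A_sub_shift h \<Longrightarrow> q + r \<in> A_sub_shift h"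
  by (simp add: A_sub_shift_def symbol_add)

lemma A_sub_shift_poly_mult: "q \<in> A_sub_shift h \<Longrightarrow> weyl_poly f * q \<in> A_sub_shift h"
  by (simp add: A_sub_shift_def symbol_poly_mult)

lemma A_sub_shift_0: "0 \<in> A_sub_shift h"
  by (simp add: A_sub_shift_def symbol_0)

lemma commutator_x_in_A_sub_shift: "a \<in> A_sub h \<Longrightarrow> commutator a weyl_x \<in> A_sub_shift h"
  by (simp add: A_sub_shift_def mem_A_sub_iff coeff_symbol_commutator_x dvd_smult
      del: power_Suc of_nat_Suc)

lemma A_sub_shift_mult_poly:
  assumes "q \<in> A_sub_shift h"
  shows "q * weyl_poly f \<in> A_sub_shift h"
  using assms
proof (induction f arbitrary: q)
  case 0
  show ?case by (simp add: weyl_poly_0 A_sub_shift_0)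
next
  case (pCons c f)
  have "q * weyl_x = weyl_poly [:0, 1:] * q + commutator q weyl_x"
    by (simp add: commutator_def weyl_poly_x)
  then have "q * weyl_x \<in> A_sub_shift h"
    using pCons(3) A_sub_shift_poly_mult commutator_x_in_A_sub_shift A_sub_shift_subset
      A_sub_shift_add by metis
  with pCons(2) have "q * weyl_x * weyl_poly f \<in> A_sub_shift h" by blast
  moreover have "weyl_poly [:c:] * q \<in> A_sub_shift h"
    by (rule A_sub_shift_poly_mult[OF pCons(3)])
  ultimately show ?case
    by (simp add: weyl_poly_pCons distrib_left A_sub_shift_add weyl_poly_0 mult.assoc
        weyl_const_comm[symmetric])
qed

lemma commutator_poly_in_A_sub_shift:
  assumes "a \<in> A_sub h"
  shows "commutator a (weyl_poly f) \<in> A_sub_shift h"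
proof (induction f)
  case 0
  show ?case by (simp add: commutator_def weyl_poly_0 A_sub_shift_0)
next
  case (pCons c f)
  have "commutator a (weyl_poly (pCons c f)) =
      commutator a weyl_x * weyl_poly f + weyl_poly [:0, 1:] * commutator a (weyl_poly f)"
    by (simp add: commutator_def weyl_poly_x weyl_poly_pCons[of c f] weyl_const_comm[of c] algebra_simps)
  then show ?case
    using A_sub_shift_mult_poly[OF commutator_x_in_A_sub_shift[OF assms], of f]
      A_sub_shift_poly_mult[OF pCons(2), of "[:0, 1:]"] by (simp add: A_sub_shift_add)
qed

text \<open>The chain rule \<open>\<delta> (f) = f' \<delta> (x)\<close> fails only because \<open>\<delta> x\<close> need not commute with \<open>x\<close>; each
  exchange of the two costs a commutator, which lies in \<^term>\<open>A_sub_shift h\<close>.\<close>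

lemma Der_poly_chain_rule:
  assumes \<delta>: "\<delta> \<in> Der UNIV" and x: "\<delta> weyl_x \<in> A_sub h"
  shows "\<delta> (weyl_poly f) - weyl_poly (pderiv f) * \<delta> weyl_x \<in> A_sub_shift h"
proof (induction f)
  case 0
  show ?case
    using Der_UNIV_const[OF \<delta>, of 0] by (simp add: weyl_poly_0 weyl_const_0 A_sub_shift_0)
next
  case (pCons c f)
  have "\<delta> (weyl_poly (pCons c f)) - weyl_poly (pderiv (pCons c f)) * \<delta> weyl_x =
      commutator (\<delta> weyl_x) (weyl_poly f) +
      weyl_poly [:0, 1:] * (\<delta> (weyl_poly f) - weyl_poly (pderiv f) * \<delta> weyl_x)"
    by (simp add: commutator_def weyl_poly_x weyl_poly_pCons pderiv_pCons Der_add[OF \<delta>]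
        Der_mult[OF \<delta>] Der_UNIV_const[OF \<delta>] weyl_poly_add weyl_const_0 weyl_const_1 weyl_poly_0 algebra_simps)
  then show ?case
    using commutator_poly_in_A_sub_shift[OF x, of f] A_sub_shift_poly_mult[OF pCons(2), of "[:0, 1:]"]
    by (simp add: A_sub_shift_add)
qed

lemma A_sub_shift_mult_y: "q \<in> A_sub_shift h \<Longrightarrow> q * weyl_y \<in> A_sub h"
  by (auto simp: A_sub_shift_def mem_A_sub_iff symbol_mult_y coeff_pCons simp del: power_Suc
      split: nat.split)

lemma y_mult_A_sub_shift: "q \<in> A_sub_shift h \<Longrightarrow> weyl_y * q \<in> A_sub h"
  by (auto simp: A_sub_shift_def mem_A_sub_iff coeff_symbol_y_mult power_dvd_pderiv simp del: power_Suc
      split: nat.split intro!: dvd_add)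

text \<open>Up to elements of \<open>A\<^sub>h\<close>, the chain rule gives \<open>[w, y h] = h' [w, x] y - h [y, w]\<close>. The
  \<open>t\<^sup>j\<close>-coefficient of the right-hand side is \<open>j h' w\<^sub>j - h w\<^sub>j'\<close>, which is zero for \<open>p\<close> dividing
  \<open>j\<close>, whereas \<open>c\<close> has only such exponents. The two summands therefore have disjoint exponents, and
  membership of their sum in \<open>A\<^sub>h\<close>, being a condition on single coefficients, passes to each.\<close>

lemma (in weyl_char_p) integral_in_normalizer:
  assumes w: "\<And>j. p dvd j \<Longrightarrow> coeff (symbol w) j = 0"
    and x: "commutator w weyl_x \<in> A_sub h"
    and c: "commutator c weyl_x = 0" "commutator w (y_hat h) + c \<in> A_sub h"
  shows "w \<in> normalizer (A_sub h)" "c \<in> A_sub h"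
proof -
  let ?u = "commutator w weyl_x"
  define q where "q = commutator w (weyl_poly h) - weyl_poly (pderiv h) * ?u"
  have chain: "commutator w (weyl_poly f) - weyl_poly (pderiv f) * ?u \<in> A_sub_shift h" for f
    by (rule Der_poly_chain_rule[OF commutator_in_Der_UNIV x])
  define t where "t = weyl_poly (pderiv h) * (?u * weyl_y) - weyl_poly h * commutator weyl_y w"
  define s where "s = q * weyl_y + commutator w (weyl_poly (pderiv h))"
  have "commutator w (weyl_poly f) \<in> A_sub h" for f
    using A_sub_add[OF A_sub_shift_subset[OF chain[of f]] A_sub_mult[OF weyl_poly_in_A_sub[of "pderiv f"] x]]
    by simp
  then have s: "s \<in> A_sub h"
    unfolding s_def using A_sub_shift_mult_y[of q h] chain[of h] by (auto simp: q_def intro: A_sub_add)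
  have split: "commutator w (y_hat h) = t + s"
    by (simp add: t_def s_def q_def y_hat_eq) (simp add: commutator_def algebra_simps)
  have t_coeff: "coeff (symbol t) j = 0" if "p dvd j" for j
    using that w[of j]
    by (cases j) (simp_all add: t_def symbol_diff symbol_poly_mult symbol_mult_y symbol_commutator_y
        coeff_map_poly coeff_symbol_commutator_x del: of_nat_Suc)
  have c_coeff: "coeff (symbol c) j = 0" if "\<not> p dvd j" for j
    using c(1) that unfolding commutes_x_iff by blast
  have "t + c \<in> A_sub h"
    using A_sub_diff[OF c(2) s] by (simp add: split)
  then have "h ^ j dvd coeff (symbol t) j + coeff (symbol c) j" for j
    unfolding mem_A_sub_iff by (simp add: symbol_add)
  then have "h ^ j dvd coeff (symbol t) j" "h ^ j dvd coeff (symbol c) j" for j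
    by (metis t_coeff c_coeff add_0_left add_0_right dvd_0_right)+
  then have "t \<in> A_sub h" "c \<in> A_sub h"
    by (simp_all add: mem_A_sub_iff)
  then show "w \<in> normalizer (A_sub h)" "c \<in> A_sub h"
    using x s split by (simp_all add: normalizer_A_sub_iff A_sub_add)
qed

section \<open>Monomial h\<close>

lemma monom_dvd_monom: "a \<le> b \<Longrightarrow> monom 1 a dvd (monom 1 b :: 'f::field poly)"
  by (auto simp: monom_1_dvd_iff')

lemma poly_y_power_in_A_sub:
  assumes "h ^ j dvd f"
  shows "weyl_poly f * weyl_y ^ j \<in> A_sub h"
  using assms by (auto simp: mem_A_sub_iff symbol_poly_mult symbol_y_power)

lemma commutator_y_hat_x: "commutator (y_hat h) weyl_x = weyl_poly h"
  unfolding symbol_inject[symmetric] symbol_commutator_x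
  by (simp add: y_hat_eq symbol_add symbol_mult_y symbol_poly pderiv_pCons)

lemma Der_poly_eq:
  assumes d: "d \<in> Der (A_sub h)" and \<delta>: "\<delta> \<in> Der UNIV" and "d weyl_x = \<delta> weyl_x"
  shows "d (weyl_poly f) = \<delta> (weyl_poly f)"
proof (induction f)
  case 0
  show ?case
    using Der_const[OF d, of 0] Der_UNIV_const[OF \<delta>, of 0] by (simp add: weyl_poly_0 weyl_const_0)
next
  case (pCons c f)
  then show ?case
    by (simp add: weyl_poly_pCons Der_add[OF d] Der_mult[OF d] Der_const[OF d] assms(3)
        Der_add[OF \<delta>] Der_mult[OF \<delta>] Der_UNIV_const[OF \<delta>]
        weyl_const_in_A_sub A_sub_mult weyl_x_in_A_sub weyl_poly_in_A_sub)
qed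

text \<open>Both cases of the classification share one pattern. The exponent \<open>r\<close> is the residue of \<open>m - 1\<close>
  modulo \<open>p\<close>, and \<open>e\<close> is the smallest multiple of \<open>p\<close> that is at least \<open>m (p - 1)\<close>, the least power of
  \<open>x\<close> for which \<open>x\<^sup>e y\<^sup>p\<^sup>-\<^sup>1\<close> lies in \<open>A\<^sub>h\<close> and \<open>x\<^sup>e\<close> is central.\<close>

locale weyl_monomial = weyl_char_p p h for p :: nat and h :: "'f::field poly" +
  fixes m r e :: nat
  assumes h: "h = monom 1 m"
    and r: "r < p" "[r + 1 = m] (mod p)"
    and e: "p dvd e" "m * (p - 1) \<le> e" "e < m * (p - 1) + p"
begin

lemma h_power: "h ^ j = monom 1 (m * j)"
  by (simp add: h monom_power)

definition E :: "'f weyl \<Rightarrow> 'f weyl" where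
  "E a = weyl_x ^ e * E_x a"

lemma E_in_Der_UNIV: "E \<in> Der UNIV"
proof -
  have "weyl_x ^ e * (a * b) = a * (weyl_x ^ e * b)" for a b :: "'f weyl"
    using x_power_central[OF e(1), of a] by (metis mult.assoc)
  then show ?thesis
    by (simp add: Der_def E_def Der_add[OF E_x_in_Der] Der_mult[OF E_x_in_Der]
        Der_UNIV_const[OF E_x_in_Der] distrib_left mult.assoc)
qed

lemma E_weyl_x: "E weyl_x = weyl_poly (monom 1 e) * weyl_y ^ (p - 1)"
  by (simp add: E_def E_x_x char weyl_poly_monom)

lemma E_weyl_x_in_A_sub: "E weyl_x \<in> A_sub h"
  unfolding E_weyl_x
  by (rule poly_y_power_in_A_sub) (simp only: h_power monom_dvd_monom[OF e(2)])

lemma e_neq: "\<not> p dvd m \<Longrightarrow> e \<noteq> m * (p - 1)"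
  using e(1) prime_p p_pos by (metis One_nat_def Suc_pred nat_dvd_not_less prime_dvd_multD prime_gt_1_nat
      lessI zero_less_diff)

text \<open>By the chain rule the value is \<open>y h' x\<^sup>e y\<^sup>p\<^sup>-\<^sup>1\<close> modulo \<open>A\<^sub>h\<close>, so the point is that \<open>h\<^sup>p\<close>
  divides \<open>h' x\<^sup>e\<close>. Either \<open>h' = 0\<close>, or \<open>p\<close> does not divide \<open>m\<close>; then \<open>e\<close>, a multiple of \<open>p\<close>,
  exceeds \<open>m (p - 1)\<close> by at least one, and this makes up for the degree lost by differentiating \<open>h\<close>.\<close>

lemma E_y_hat_in_A_sub: "E (y_hat h) \<in> A_sub h"
proof -
  let ?f = "pderiv h * monom 1 e"
  have "h ^ p dvd ?f"
  proof (cases "p dvd m")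
    case True
    then have "of_nat m = (0 :: 'f)" by (simp only: of_nat_eq_0)
    then show ?thesis by (simp add: h pderiv_monom)
  next
    case False
    then have "m > 0" "e > m * (p - 1)" using e(2) e_neq by (auto intro: Nat.gr0I le_neq_implies_less)
    then have "m * p \<le> m - 1 + e"
      using p_pos by (cases p; cases m) auto
    then have "monom 1 (m * p) dvd (monom 1 (m - 1 + e) :: 'f poly)"
      by (rule monom_dvd_monom)
    moreover have "?f = smult (of_nat m) (monom 1 (m - 1 + e))"
      by (simp add: h pderiv_monom mult_monom smult_monom)
    ultimately show ?thesis by (simp add: h_power dvd_smult)
  qed
  moreover from this have "h ^ (p - 1) dvd pderiv ?f"
    using power_dvd_pderiv[of h "p - 1" ?f] p_pos by simp
  ultimately have top: "weyl_poly ?f * weyl_y ^ p + weyl_poly (pderiv ?f) * weyl_y ^ (p - 1) \<in> A_sub h"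
    by (intro A_sub_add poly_y_power_in_A_sub)
  define q where "q = E (weyl_poly h) - weyl_poly (pderiv h) * E weyl_x"
  have q: "weyl_y * q \<in> A_sub h"
    unfolding q_def by (intro y_mult_A_sub_shift Der_poly_chain_rule E_in_Der_UNIV E_weyl_x_in_A_sub)
  have "E (y_hat h) = weyl_y * E (weyl_poly h)"
    by (simp add: y_hat_def Der_mult[OF E_in_Der_UNIV]) (simp add: E_def E_x_y)
  also have "\<dots> = weyl_y * q + weyl_y * weyl_poly ?f * weyl_y ^ (p - 1)"
    by (simp add: q_def E_weyl_x weyl_poly_mult distrib_left[symmetric] mult.assoc)
  also have "weyl_y * weyl_poly ?f * weyl_y ^ (p - 1) =
      weyl_poly ?f * weyl_y ^ p + weyl_poly (pderiv ?f) * weyl_y ^ (p - 1)"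
    using p_pos by (cases p) (simp_all only: weyl_y_poly distrib_right mult.assoc power_Suc diff_Suc_1)
  finally show ?thesis
    using A_sub_add[OF q top] by simp
qed

text \<open>The coefficients of \<open>g\<close> are polynomials in \<open>x\<^sup>p\<close>, so divisibility by a power of \<open>x\<close> improves
  to the next exponent divisible by \<open>p\<close>.\<close>

lemma center_divisible:
  assumes g: "g \<in> center (A_sub h)" and "\<And>j. p dvd j \<Longrightarrow> h ^ (j + (p - 1)) dvd coeff (symbol g) j"
  shows "\<exists>z \<in> center (A_sub h). g = z * weyl_x ^ e"
proof -
  have g_coeffs: "\<not> p dvd j \<Longrightarrow> coeff (symbol g) j = 0" "pderiv (coeff (symbol g) j) = 0" for j
    using g by (simp_all add: mem_center_iff_coeffs)
  have dvd: "monom 1 (m * j + e) dvd coeff (symbol g) j" for j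
  proof (cases "p dvd j")
    case True
    have "coeff (coeff (symbol g) j) i = 0" if "i < m * j + e" for i
    proof (cases "p dvd i")
      case pi: True
      have "p dvd m * j + e" using True e(1) by simp
      then have "p \<le> m * j + e - i" using pi that by (auto intro!: dvd_imp_le)
      then have "i < m * (j + (p - 1))" using that e(3) unfolding distrib_left by linarith
      with assms(2)[OF True] show ?thesis
        by (simp add: h_power monom_1_dvd_iff')
    qed (use g_coeffs(2)[of j] in \<open>simp add: pderiv_eq_0_iff\<close>)
    then show ?thesis by (simp add: monom_1_dvd_iff')
  qed (simp add: g_coeffs)
  have "[:monom 1 e:] dvd symbol g"
    unfolding const_poly_dvd_iff using dvd by (metis dvd_mult_right mult_monom mult_1)
  then obtain q where q: "symbol g = smult (monom 1 e) q"
    by (auto simp: dvd_def)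
  define z where "z = of_symbol q"
  have gz: "g = weyl_poly (monom 1 e) * z"
    by (simp add: z_def symbol_poly_mult symbol_of_symbol q flip: symbol_inject)
  have "z \<in> center (A_sub h)"
    unfolding mem_center_iff_coeffs
  proof (intro conjI allI impI)
    show "z \<in> A_sub h"
      unfolding mem_A_sub_iff
    proof
      fix j
      have "monom 1 e * h ^ j dvd monom 1 e * coeff (symbol z) j"
        using dvd[of j] by (simp add: gz symbol_poly_mult h_power mult_monom add.commute)
      then show "h ^ j dvd coeff (symbol z) j" by (simp add: dvd_mult_cancel_left)
    qed
    show "coeff (symbol z) j = 0" if "\<not> p dvd j" for j
      using g_coeffs(1)[OF that] by (simp add: gz symbol_poly_mult)
    have "pderiv (monom 1 e :: 'f poly) = 0"
      using e(1) by (simp add: pderiv_monom of_nat_eq_0)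
    then show "pderiv (coeff (symbol z) j) = 0" for j
      using g_coeffs(2)[of j] by (simp add: gz symbol_poly_mult pderiv_mult)
  qed
  moreover have "g = z * weyl_x ^ e"
    by (simp add: gz weyl_poly_monom x_power_central[OF e(1)])
  ultimately show ?thesis by blast
qed

text \<open>The span of monomials in the theorem, described by coefficients.\<close>

definition S :: "'f poly set" where
  "S = {s. \<forall>i. coeff s i \<noteq> 0 \<longrightarrow> i < m \<and> \<not> [i + 1 = m] (mod p)}"

lemma residue_iff: "[i + 1 = m] (mod p) \<longleftrightarrow> r \<le> i \<and> p dvd i - r"
proof -
  have "[i + 1 = m] (mod p) \<longleftrightarrow> [i = r] (mod p)"
    using r(2) by (metis cong_add_rcancel_nat cong_sym cong_trans)
  also have "\<dots> \<longleftrightarrow> r \<le> i \<and> p dvd i - r"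
  proof (cases "r \<le> i")
    case True
    then show ?thesis by (simp add: cong_altdef_nat)
  next
    case False
    then show ?thesis using r(1) by (simp add: cong_def)
  qed
  finally show ?thesis .
qed

lemma coeff_h_mult_pderiv:
  "coeff (h * pderiv g) i = (if i < m then 0 else of_nat (i - m + 1) * coeff g (i - m + 1))"
  by (simp add: h coeff_monom_mult coeff_pderiv)

text \<open>The exponents \<open>i \<equiv> m - 1\<close> are those that derivatives, multiplied by \<open>x\<^sup>m\<close>, never reach.\<close>

lemma coeff_h_mult_pderiv_residue: "[i + 1 = m] (mod p) \<Longrightarrow> coeff (h * pderiv g) i = 0"
proof (cases "i < m")
  case False
  moreover assume "[i + 1 = m] (mod p)"
  ultimately have "p dvd i - m + 1"
    using cong_altdef_nat[of m "i + 1" p] by (simp add: Suc_diff_le)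
  then have "of_nat (i - m + 1) = (0 :: 'f)"
    by (simp only: of_nat_eq_0)
  then show ?thesis
    by (simp only: coeff_h_mult_pderiv mult_zero_left if_cancel)
qed (simp add: coeff_h_mult_pderiv)

text \<open>The monomials of \<open>q\<close> are distributed by exponent: those congruent to \<open>m - 1\<close> make up \<open>x\<^sup>r z\<close>,
  the others are integrated into \<open>h g'\<close> if the exponent is at least \<open>m\<close>, and form \<open>s\<close> otherwise.\<close>

lemma poly_decomposition:
  assumes N: "p dvd N" "monom 1 N dvd q"
  shows "\<exists>z s g. q = monom 1 r * z + s - h * pderiv g \<and> pderiv z = 0 \<and> monom 1 N dvd z \<and>
    s \<in> S \<and> (m \<le> N \<longrightarrow> s = 0) \<and> (q = 0 \<longrightarrow> z = 0 \<and> g = 0)"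
proof (cases "q = 0")
  case True
  then show ?thesis by (intro exI[of _ 0]) (simp add: S_def)
next
  case False
  let ?R = "\<lambda>i. [i + 1 = m] (mod p)"
  define D where "D = Polynomial.degree q"
  have high: "coeff q i = 0" if "i > D" for i
    using that by (simp add: D_def coeff_eq_0)
  have low: "coeff q i = 0" if "i < N" for i
    using N(2) that by (simp add: monom_1_dvd_iff')
  obtain z where z: "\<And>i. coeff z i = (if p dvd i then coeff q (i + r) else 0)"
    using poly_with_coeffs_exists[of D "\<lambda>i. if p dvd i then coeff q (i + r) else 0"] high by fastforce
  obtain s where s: "\<And>i. coeff s i = (if i < m \<and> \<not> ?R i then coeff q i else 0)"
    using poly_with_coeffs_exists[of D "\<lambda>i. if i < m \<and> \<not> ?R i then coeff q i else 0"] high by fastforce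
  obtain g where g: "\<And>i. coeff g i = (if p dvd i then 0 else - coeff q (i + m - 1) / of_nat i)"
    using poly_with_coeffs_exists[of "Suc D" "\<lambda>i. if p dvd i then 0 else - coeff q (i + m - 1) / of_nat i"]
      high by fastforce
  have "coeff q i = coeff (monom 1 r * z + s - h * pderiv g) i" for i
  proof (cases "?R i")
    case True
    moreover from this have "r \<le> i" "p dvd i - r" by (simp_all only: residue_iff)
    ultimately show ?thesis
      using coeff_h_mult_pderiv_residue[OF True, of g] by (simp add: coeff_monom_mult z s)
  next
    case False
    moreover from this have "r \<le> i \<Longrightarrow> \<not> p dvd i - r" by (simp only: residue_iff) simp
    moreover have "coeff (h * pderiv g) i = - coeff q i" if "m \<le> i"
    proof -
      have "\<not> p dvd i - m + 1"
        using False that cong_altdef_nat[of m "i + 1" p] by (simp add: Suc_diff_le)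
      moreover from this have "of_nat (i - m + 1) \<noteq> (0 :: 'f)" by (simp only: of_nat_eq_0) simp
      ultimately show ?thesis
        using that by (simp add: coeff_h_mult_pderiv g del: of_nat_Suc of_nat_add)
    qed
    ultimately show ?thesis
      by (cases "i < m") (auto simp: coeff_monom_mult z s coeff_h_mult_pderiv[of g i])
  qed
  then have "q = monom 1 r * z + s - h * pderiv g" by (simp add: poly_eq_iff)
  moreover have "pderiv z = 0" by (simp add: pderiv_eq_0_iff z)
  moreover have "monom 1 N dvd z"
  proof -
    have "coeff q (i + r) = 0" if "p dvd i" "i < N" for i
    proof -
      have "p \<le> N - i" using that N(1) by (auto intro!: dvd_imp_le)
      then show ?thesis using r(1) by (intro low) linarith
    qed
    then show ?thesis by (simp add: monom_1_dvd_iff' z)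
  qed
  moreover have "s \<in> S" by (auto simp: S_def s)
  moreover have "m \<le> N \<longrightarrow> s = 0" using low by (auto simp: poly_eq_iff s)
  ultimately show ?thesis using False by blast
qed

text \<open>For \<open>v\<close> commuting with \<open>x\<close>, the symbol of \<open>[v, y h]\<close> is \<open>- h dv/dx\<close>, so the decomposition of
  polynomials applies to each coefficient. Every nonconstant coefficient sits at some \<open>j \<ge> p\<close> and is
  divisible by \<open>h\<^sup>j\<close>, so only the constant one contributes to \<open>S\<close>.\<close>

lemma centralizer_decomposition:
  assumes c: "c \<in> A_sub h" "commutator c weyl_x = 0"
  obtains z s v where "z \<in> center (A_sub h)" "s \<in> S" "commutator v weyl_x = 0"
    "c = z * weyl_poly (monom 1 r) + weyl_poly s + commutator v (y_hat h)"
proof -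
  have c_coeff: "coeff (symbol c) j = 0" if "\<not> p dvd j" for j
    using c(2) that by (simp add: commutes_x_iff)
  have "\<exists>z s g. coeff (symbol c) j = monom 1 r * z + s - h * pderiv g \<and> pderiv z = 0 \<and> h ^ j dvd z \<and>
    s \<in> S \<and> (j \<noteq> 0 \<longrightarrow> s = 0) \<and> (coeff (symbol c) j = 0 \<longrightarrow> z = 0 \<and> g = 0)" for j
  proof (cases "p dvd j")
    case True
    then show ?thesis
      using poly_decomposition[of "m * j" "coeff (symbol c) j"] c(1)
      by (cases "j = 0") (auto simp: mem_A_sub_iff h_power)
  next
    case False
    then show ?thesis
      using c_coeff[OF False] by (intro exI[of _ 0]) (simp add: S_def)
  qed
  then obtain Z s G where dec: "\<And>j. coeff (symbol c) j = monom 1 r * Z j + s j - h * pderiv (G j)"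
    "\<And>j. pderiv (Z j) = 0" "\<And>j. h ^ j dvd Z j" "s 0 \<in> S" "\<And>j. j \<noteq> 0 \<Longrightarrow> s j = 0"
    "\<And>j. coeff (symbol c) j = 0 \<Longrightarrow> Z j = 0 \<and> G j = 0"
    by metis
  have high: "coeff (symbol c) j = 0" if "Polynomial.degree (symbol c) < j" for j
    using that by (rule coeff_eq_0)
  obtain z where z: "\<And>j. coeff (symbol z) j = Z j"
    using weyl_with_coeffs_exists[of "Polynomial.degree (symbol c)" Z] dec(6) high by blast
  obtain v where v: "\<And>j. coeff (symbol v) j = G j"
    using weyl_with_coeffs_exists[of "Polynomial.degree (symbol c)" G] dec(6) high by blast
  have "z \<in> center (A_sub h)"
    using dec(2,3,6) c_coeff by (simp add: mem_center_iff_coeffs mem_A_sub_iff z)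
  moreover have vx: "commutator v weyl_x = 0"
    using dec(6) c_coeff by (simp add: commutes_x_iff v)
  moreover have "c = z * weyl_poly (monom 1 r) + weyl_poly (s 0) + commutator v (y_hat h)"
  proof -
    have "z * weyl_poly (monom 1 r) = weyl_poly (monom 1 r) * z"
      using \<open>z \<in> center (A_sub h)\<close> by (simp add: mem_center_iff)
    moreover have "symbol c = symbol (weyl_poly (monom 1 r) * z + weyl_poly (s 0) + commutator v (y_hat h))"
    proof (rule poly_eqI)
      show "coeff (symbol c) j = coeff (symbol (weyl_poly (monom 1 r) * z + weyl_poly (s 0) +
        commutator v (y_hat h))) j" for j
        using dec(1)[of j] dec(5)[of j]
        by (cases j) (simp_all add: commutator_y_hat_of_centralizer[OF vx] symbol_add symbol_diff
            symbol_poly_mult symbol_poly symbol_commutator_y coeff_map_poly z v)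
    qed
    ultimately show ?thesis
      by (simp add: symbol_inject)
  qed
  ultimately show thesis using that dec(4) by blast
qed

end

section \<open>The direct sum decomposition\<close>

lemma center_mult_subspace:
  "module.subspace fun_scale (center_multiples (A_sub h) d)"
proof -
  interpret vector_space fun_scale by (rule vector_space_fun_scale)
  show ?thesis
    unfolding subspace_def
  proof (intro conjI ballI allI)
    show "0 \<in> center_multiples (A_sub h) d"
      unfolding center_multiples_def
      by (rule CollectI, rule exI[of _ 0]) (auto simp: center_def A_sub_0 restrict0_def)
  next
    fix f g assume "f \<in> center_multiples (A_sub h) d" "g \<in> center_multiples (A_sub h) d"
    then obtain z z' where z: "z \<in> center (A_sub h)" "z' \<in> center (A_sub h)"
      "f = restrict0 (A_sub h) (\<lambda>a. z * d a)" "g = restrict0 (A_sub h) (\<lambda>a. z' * d a)"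
      by (auto simp: center_multiples_def)
    then have "f + g = restrict0 (A_sub h) (\<lambda>a. (z + z') * d a)"
      by (auto simp: restrict0_def distrib_right)
    moreover have "z + z' \<in> center (A_sub h)"
      using z by (simp add: center_def A_sub_add distrib_left distrib_right)
    ultimately show "f + g \<in> center_multiples (A_sub h) d"
      unfolding center_multiples_def by blast
  next
    fix c f assume "f \<in> center_multiples (A_sub h) d"
    then obtain z where z: "z \<in> center (A_sub h)" "f = restrict0 (A_sub h) (\<lambda>a. z * d a)"
      by (auto simp: center_multiples_def)
    then have "fun_scale c f = restrict0 (A_sub h) (\<lambda>a. (weyl_const c * z) * d a)"
      by (auto simp: restrict0_def fun_scale_def mult.assoc)
    moreover have "weyl_const c * z \<in> center (A_sub h)"
      using z(1) by (simp add: center_def A_sub_mult weyl_const_in_A_sub weyl_const_left_comm mult.assoc)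
    ultimately show "fun_scale c f \<in> center_multiples (A_sub h) d"
      unfolding center_multiples_def by blast
  qed
qed

lemma ad_normalizer_subspace: "module.subspace fun_scale (ad (A_sub h) ` normalizer (A_sub h))"
proof -
  interpret vector_space fun_scale by (rule vector_space_fun_scale)
  have add: "commutator (u + v) a = commutator u a + commutator v a" for u v a :: "'a weyl"
    by (simp add: commutator_def algebra_simps)
  have scale: "commutator (weyl_const c * u) a = weyl_const c * commutator u a" for c and u a :: "'a weyl"
    by (simp add: commutator_def right_diff_distrib mult.assoc weyl_const_left_comm)
  show ?thesis
    unfolding subspace_def
  proof (intro conjI ballI allI)
    have "ad (A_sub h) 0 = 0" "0 \<in> normalizer (A_sub h)"
      by (auto simp: ad_def restrict0_def commutator_def normalizer_def A_sub_0)
    then show "0 \<in> ad (A_sub h) ` normalizer (A_sub h)" by (metis imageI)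
  next
    fix f g assume "f \<in> ad (A_sub h) ` normalizer (A_sub h)" "g \<in> ad (A_sub h) ` normalizer (A_sub h)"
    then obtain u v where uv: "u \<in> normalizer (A_sub h)" "v \<in> normalizer (A_sub h)"
      "f = ad (A_sub h) u" "g = ad (A_sub h) v" by auto
    then have "f + g = ad (A_sub h) (u + v)"
      by (auto simp: ad_def restrict0_def add)
    moreover have "u + v \<in> normalizer (A_sub h)"
      using uv by (simp add: normalizer_def add A_sub_add)
    ultimately show "f + g \<in> ad (A_sub h) ` normalizer (A_sub h)" by blast
  next
    fix c f assume "f \<in> ad (A_sub h) ` normalizer (A_sub h)"
    then obtain u where u: "u \<in> normalizer (A_sub h)" "f = ad (A_sub h) u" by auto
    then have "fun_scale c f = ad (A_sub h) (weyl_const c * u)"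
      by (auto simp: ad_def restrict0_def scale fun_scale_def)
    moreover have "weyl_const c * u \<in> normalizer (A_sub h)"
      using u by (simp add: normalizer_def scale A_sub_mult weyl_const_in_A_sub)
    ultimately show "fun_scale c f \<in> ad (A_sub h) ` normalizer (A_sub h)" by blast
  qed
qed

lemma fun_scale_in_Der:
  assumes d: "d \<in> Der (A_sub h)"
  shows "fun_scale c d \<in> Der (A_sub h)"
proof -
  have "fun_scale c d = restrict0 (A_sub h) (\<lambda>a. weyl_const c * d a)"
    using Der_outside[OF d] by (auto simp: fun_scale_def restrict0_def)
  moreover have "weyl_const c * (a * d b) = a * (weyl_const c * d b)" for a b
    by (simp only: weyl_const_left_comm)
  ultimately show ?thesis
    using Der_closed[OF d]
    by (auto simp: Der_def restrict0_def Der_add[OF d] Der_mult[OF d] Der_const[OF d]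
        A_sub_add A_sub_mult weyl_const_in_A_sub distrib_left mult.assoc)
qed

lemma (in weyl_char_p) D_der_image_subspace:
  assumes "module.subspace smult T"
  shows "module.subspace fun_scale (D_der h ` T)"
proof -
  interpret P: vector_space "smult :: 'f \<Rightarrow> 'f poly \<Rightarrow> 'f poly" by (rule vector_space_smult)
  interpret vector_space "fun_scale :: 'f \<Rightarrow> ('f weyl \<Rightarrow> 'f weyl) \<Rightarrow> _" by (rule vector_space_fun_scale)
  have D: "D_der h t \<in> Der (A_sub h)" "D_der h t weyl_x = 0" "D_der h t (y_hat h) = weyl_poly t" for t
    using D_der_in_Der D_der_x D_der_y_hat h_nonzero char p_pos by blast+
  have "D_der h 0 = 0"
    by (rule Der_eqI[OF D(1) zero_in_Der]) (simp_all add: D weyl_poly_0)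
  moreover have add: "D_der h (s + t) = D_der h s + D_der h t" for s t
    by (rule Der_eqI[OF D(1) add_in_Der[OF D(1) D(1)]]) (simp_all add: D weyl_poly_add)
  moreover have scale: "D_der h (smult c t) = fun_scale c (D_der h t)" for c t
    by (rule Der_eqI[OF D(1) fun_scale_in_Der[OF D(1)]]) (simp_all add: D fun_scale_def weyl_poly_smult)
  ultimately show ?thesis
    using assms unfolding subspace_def P.subspace_def
    by (auto simp: add[symmetric] scale[symmetric] intro: rev_image_eqI)
qed

lemma is_direct_sum_4I:
  fixes scale :: "'f::field \<Rightarrow> 'v::ab_group_add \<Rightarrow> 'v"
  assumes vs: "vector_space scale"
    and sub: "module.subspace scale W1" "module.subspace scale W2" "module.subspace scale W3"
      "module.subspace scale W4"
    and sum: "\<And>a b c d. \<lbrakk>a \<in> W1; b \<in> W2; c \<in> W3; d \<in> W4\<rbrakk> \<Longrightarrow> a + b + c + d \<in> V"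
    and span: "\<And>v. v \<in> V \<Longrightarrow> \<exists>a\<in>W1. \<exists>b\<in>W2. \<exists>c\<in>W3. \<exists>d\<in>W4. v = a + b + c + d"
    and indep: "\<And>a b c d. \<lbrakk>a \<in> W1; b \<in> W2; c \<in> W3; d \<in> W4; a + b + c + d = 0\<rbrakk>
      \<Longrightarrow> a = 0 \<and> b = 0 \<and> c = 0 \<and> d = 0"
  shows "is_direct_sum scale V [W1, W2, W3, W4]"
proof -
  interpret vector_space scale by (rule vs)
  have listset: "listset [W1, W2, W3, W4] = {[a, b, c, d] | a b c d. a \<in> W1 \<and> b \<in> W2 \<and> c \<in> W3 \<and> d \<in> W4}"
    by (auto simp: set_Cons_def)
  have "bij_betw sum_list (listset [W1, W2, W3, W4]) V"
    unfolding listset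
  proof (rule bij_betw_imageI)
    show "inj_on sum_list {[a, b, c, d] | a b c d. a \<in> W1 \<and> b \<in> W2 \<and> c \<in> W3 \<and> d \<in> W4}"
    proof (rule inj_onI)
      fix xs ys
      assume "xs \<in> {[a, b, c, d] | a b c d. a \<in> W1 \<and> b \<in> W2 \<and> c \<in> W3 \<and> d \<in> W4}"
        "ys \<in> {[a, b, c, d] | a b c d. a \<in> W1 \<and> b \<in> W2 \<and> c \<in> W3 \<and> d \<in> W4}"
        and eq: "sum_list xs = sum_list ys"
      then obtain a b c d a' b' c' d' where xs: "xs = [a, b, c, d]" and ys: "ys = [a', b', c', d']"
        and mem: "a \<in> W1" "b \<in> W2" "c \<in> W3" "d \<in> W4" "a' \<in> W1" "b' \<in> W2" "c' \<in> W3" "d' \<in> W4"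
        by blast
      from eq have "(a - a') + (b - b') + (c - c') + (d - d') = 0"
        by (simp add: xs ys algebra_simps)
      then have "a - a' = 0 \<and> b - b' = 0 \<and> c - c' = 0 \<and> d - d' = 0"
        using mem sub by (intro indep) (auto intro: subspace_diff)
      then show "xs = ys" by (simp add: xs ys)
    qed
    show "sum_list ` {[a, b, c, d] | a b c d. a \<in> W1 \<and> b \<in> W2 \<and> c \<in> W3 \<and> d \<in> W4} = V"
    proof (intro equalityI subsetI)
      fix v assume "v \<in> V"
      then obtain a b c d where "a \<in> W1" "b \<in> W2" "c \<in> W3" "d \<in> W4" "v = a + b + c + d"
        using span by blast
      then show "v \<in> sum_list ` {[a, b, c, d] | a b c d. a \<in> W1 \<and> b \<in> W2 \<and> c \<in> W3 \<and> d \<in> W4}"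
        by (intro image_eqI[of _ _ "[a, b, c, d]"]) (auto simp: add.assoc)
    qed (use sum in \<open>auto simp: add.assoc\<close>)
  qed
  then show ?thesis using sub by (simp add: is_direct_sum_def)
qed

context weyl_monomial
begin

lemma D_der: "D_der h t \<in> Der (A_sub h)" "D_der h t weyl_x = 0" "D_der h t (y_hat h) = weyl_poly t"
  using D_der_in_Der D_der_x D_der_y_hat h_nonzero char p_pos by blast+

lemma restrict_E_in_Der:
  assumes "z \<in> center (A_sub h)"
  shows "restrict0 (A_sub h) (\<lambda>a. z * E a) \<in> Der (A_sub h)"
proof -
  have "restrict0 (A_sub h) (\<lambda>a. z * E a) =
      restrict0 (A_sub h) (\<lambda>a. z * restrict0 (A_sub h) E a)"
    by (auto simp: restrict0_def)
  then show ?thesis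
    using center_mult_in_Der[OF assms
        restrict_in_Der[OF E_in_Der_UNIV E_weyl_x_in_A_sub E_y_hat_in_A_sub]] by simp
qed

lemma restrict0_gens [simp]:
  "restrict0 (A_sub h) d weyl_x = d weyl_x" "restrict0 (A_sub h) d (y_hat h) = d (y_hat h)"
  by (simp_all add: restrict0_def weyl_x_in_A_sub y_hat_in_A_sub)

text \<open>The value at \<open>x\<close> determines the multiple of \<^const>\<open>E_x\<close> and an element \<open>w\<close> of the normalizer;
  subtracting both leaves a derivation that kills \<open>x\<close>. Its value at \<open>y h\<close> commutes with \<open>x\<close>, and the
  decomposition of the centralizer supplies the other summands.\<close>

lemma Der_decomposition:
  assumes d: "d \<in> Der (A_sub h)"
  obtains z1 z2 s w where "z1 \<in> center (A_sub h)" "z2 \<in> center (A_sub h)" "s \<in> S"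
    "w \<in> normalizer (A_sub h)"
    "d = restrict0 (A_sub h) (\<lambda>a. z1 * D_der h (monom 1 r) a) +
      restrict0 (A_sub h) (\<lambda>a. z2 * E a) + D_der h s + ad (A_sub h) w"
proof -
  obtain g w where g: "g \<in> center (A_sub h)"
    and dx: "d weyl_x = g * weyl_y ^ (p - 1) + commutator w weyl_x"
    and w: "\<And>j. p dvd j \<Longrightarrow> coeff (symbol w) j = 0"
    and g_coeff: "\<And>j. p dvd j \<Longrightarrow> coeff (symbol g) j = coeff (symbol (d weyl_x)) (j + (p - 1))"
    using Der_x_decomposition[OF d] by blast
  have "h ^ (j + (p - 1)) dvd coeff (symbol g) j" if "p dvd j" for j
    using Der_closed[OF d weyl_x_in_A_sub] g_coeff[OF that] by (simp only: mem_A_sub_iff)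
  then obtain z2 where z2: "z2 \<in> center (A_sub h)" "g = z2 * weyl_x ^ e"
    using center_divisible[OF g] by blast
  let ?E = "restrict0 (A_sub h) (\<lambda>a. z2 * E a)"
  have E: "?E \<in> Der (A_sub h)" by (rule restrict_E_in_Der[OF z2(1)])
  define d1 where "d1 = d + fun_scale (- 1) ?E"
  have d1: "d1 \<in> Der (A_sub h)"
    unfolding d1_def by (intro add_in_Der d fun_scale_in_Der E)
  have d_eq: "d = d1 + ?E"
    by (simp add: d1_def fun_scale_def fun_eq_iff weyl_const_uminus weyl_const_1)
  have d1x: "d1 weyl_x = commutator w weyl_x"
    by (simp add: d1_def fun_scale_def weyl_const_uminus weyl_const_1 dx z2(2) E_def E_x_x char mult.assoc)
  define c where "c = d1 (y_hat h) - commutator w (y_hat h)"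
  have cx: "commutator c weyl_x = 0"
  proof -
    have "d1 (commutator (y_hat h) weyl_x) = commutator w (commutator (y_hat h) weyl_x)"
      unfolding commutator_y_hat_x
      by (rule Der_poly_eq[OF d1 commutator_in_Der_UNIV]) (simp add: d1x)
    moreover have "d1 (commutator (y_hat h) weyl_x) =
        commutator (d1 (y_hat h)) weyl_x + commutator (y_hat h) (commutator w weyl_x)"
      by (simp add: commutator_def[of "y_hat h"] Der_diff[OF d1] Der_mult[OF d1] A_sub_mult
          weyl_x_in_A_sub y_hat_in_A_sub d1x) (simp add: commutator_def)
    ultimately show ?thesis
      by (simp add: c_def commutator_def algebra_simps)
  qed
  have x: "commutator w weyl_x \<in> A_sub h" and y: "commutator w (y_hat h) + c \<in> A_sub h"
    using Der_closed[OF d1 weyl_x_in_A_sub] Der_closed[OF d1 y_hat_in_A_sub] by (simp_all add: d1x c_def)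
  have wN: "w \<in> normalizer (A_sub h)" and c: "c \<in> A_sub h"
    using integral_in_normalizer[OF w x cx y] by blast+
  obtain z1 s v where z1: "z1 \<in> center (A_sub h)" and s: "s \<in> S" and vx: "commutator v weyl_x = 0"
    and c_eq: "c = z1 * weyl_poly (monom 1 r) + weyl_poly s + commutator v (y_hat h)"
    using centralizer_decomposition[OF c cx] by blast
  have "commutator v (y_hat h) = c - z1 * weyl_poly (monom 1 r) - weyl_poly s"
    by (simp add: c_eq)
  then have "commutator v (y_hat h) \<in> A_sub h"
    using z1 c by (auto simp: center_def intro!: A_sub_diff A_sub_mult weyl_poly_in_A_sub)
  moreover have comm_add: "commutator (a + b) q = commutator a q + commutator b q" for a b q :: "'f weyl"
    by (simp add: commutator_def algebra_simps)
  ultimately have N: "w + v \<in> normalizer (A_sub h)"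
    using wN vx by (simp add: normalizer_A_sub_iff A_sub_add)
  let ?D = "restrict0 (A_sub h) (\<lambda>a. z1 * D_der h (monom 1 r) a)"
  have "d1 = ?D + D_der h s + ad (A_sub h) (w + v)"
  proof (rule Der_eqI[OF d1])
    show "?D + D_der h s + ad (A_sub h) (w + v) \<in> Der (A_sub h)"
      by (intro add_in_Der center_mult_in_Der z1 D_der ad_in_Der N)
    show "d1 weyl_x = (?D + D_der h s + ad (A_sub h) (w + v)) weyl_x"
      "d1 (y_hat h) = (?D + D_der h s + ad (A_sub h) (w + v)) (y_hat h)"
      using c_eq by (simp_all add: ad_def D_der d1x vx c_def comm_add algebra_simps)
  qed
  then have "d = ?D + ?E + D_der h s + ad (A_sub h) (w + v)"
    by (simp add: d_eq add_ac)
  then show thesis using that z1 z2 s N by blast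
qed

text \<open>Evaluation at \<open>x\<close> separates \<open>z\<^sub>2\<close>, whose contribution has only exponents congruent to \<open>-1\<close>
  in \<open>t\<close>, from the commutator, which has none of them. Then \<open>w\<close> commutes with \<open>x\<close>, and evaluation
  at \<open>y h\<close> compares three polynomials in \<open>x\<close> with disjoint sets of exponents.\<close>

lemma Der_decomposition_unique:
  assumes z: "z1 \<in> center (A_sub h)" "z2 \<in> center (A_sub h)" and s: "s \<in> S"
    and w: "w \<in> normalizer (A_sub h)"
    and sum: "restrict0 (A_sub h) (\<lambda>a. z1 * D_der h (monom 1 r) a) +
      restrict0 (A_sub h) (\<lambda>a. z2 * E a) + D_der h s + ad (A_sub h) w = 0"
  shows "z1 = 0" "z2 = 0" "s = 0" "ad (A_sub h) w = 0"
proof -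
  have eval: "(restrict0 (A_sub h) (\<lambda>a. z1 * D_der h (monom 1 r) a) +
      restrict0 (A_sub h) (\<lambda>a. z2 * E a) + D_der h s + ad (A_sub h) w) a = 0" for a
    by (simp add: sum)
  have x: "z2 * E weyl_x + commutator w weyl_x = 0"
    using eval[of weyl_x] by (simp add: ad_def D_der)
  have "coeff (symbol z2) j = 0" for j
  proof (cases "p dvd j")
    case True
    have "z2 * weyl_poly (monom 1 e) = weyl_poly (monom 1 e) * z2"
      using z(2) by (simp add: mem_center_iff)
    then have "z2 * E weyl_x = weyl_poly (monom 1 e) * (z2 * weyl_y ^ (p - 1))"
      by (simp only: E_weyl_x mult.assoc[symmetric])
    then have "monom 1 e * coeff (symbol z2) j + smult (of_nat (Suc (j + (p - 1)))) (coeff (symbol w) (Suc (j + (p - 1)))) = 0"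
      using arg_cong[OF x, of "\<lambda>a. coeff (symbol a) (j + (p - 1))"]
      by (simp add: symbol_add symbol_poly_mult coeff_symbol_mult_y_power coeff_symbol_commutator_x symbol_0
          del: of_nat_Suc)
    moreover have "p dvd Suc (j + (p - 1))"
      using True p_pos by simp
    then have "of_nat (Suc (j + (p - 1))) = (0 :: 'f)" by (simp only: of_nat_eq_0)
    ultimately have "monom 1 e * coeff (symbol z2) j = 0"
      by (simp del: of_nat_Suc)
    then show ?thesis by simp
  qed (use z(2) in \<open>simp add: mem_center_iff_coeffs\<close>)
  then have "symbol z2 = symbol 0" by (simp add: symbol_0 poly_eq_iff[where 'a = "'f poly"])
  then show z2: "z2 = 0" by (simp only: symbol_inject)
  have wx: "commutator w weyl_x = 0" using x z2 by simp
  have "z1 * weyl_poly (monom 1 r) + weyl_poly s + commutator w (y_hat h) = 0"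
    using eval[of "y_hat h"] by (simp add: ad_def D_der z2)
  moreover have "z1 * weyl_poly (monom 1 r) = weyl_poly (monom 1 r) * z1"
    using z(1) by (simp add: mem_center_iff)
  ultimately have y: "weyl_poly (monom 1 r) * z1 + weyl_poly s + commutator w (y_hat h) = 0"
    by simp
  have coeffs: "monom 1 r * coeff (symbol z1) j + (if j = 0 then s else 0) =
      h * pderiv (coeff (symbol w) j)" for j
    using arg_cong[OF y, of "\<lambda>a. coeff (symbol a) j"]
    by (cases j) (simp_all add: commutator_y_hat_of_centralizer[OF wx] symbol_add symbol_diff symbol_poly_mult symbol_poly
        symbol_commutator_y coeff_map_poly symbol_0)
  have "coeff (coeff (symbol z1) j) i = 0" for i j
  proof (cases "p dvd i")
    case True
    then have R: "[(i + r) + 1 = m] (mod p)" by (simp only: residue_iff) simp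
    have "coeff s (i + r) = 0" using s R by (auto simp: S_def)
    then show ?thesis
      using arg_cong[OF coeffs[of j], of "\<lambda>f. coeff f (i + r)"] coeff_h_mult_pderiv_residue[OF R]
      by (cases "j = 0") (simp_all add: coeff_monom_mult)
  next
    case False
    then show ?thesis using z(1) by (simp add: mem_center_iff_coeffs pderiv_eq_0_iff)
  qed
  then have "symbol z1 = symbol 0" by (simp add: symbol_0 poly_eq_iff)
  then show z1: "z1 = 0" by (simp only: symbol_inject)
  have "coeff s i = 0" for i
  proof (cases "i < m")
    case True
    then show ?thesis
      using arg_cong[OF coeffs[of 0], of "\<lambda>f. coeff f i"] z1
      by (simp add: symbol_0 coeff_h_mult_pderiv)
  qed (use s in \<open>auto simp: S_def\<close>)
  then show s0: "s = 0" by (simp add: poly_eq_iff)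
  show "ad (A_sub h) w = 0"
  proof (rule Der_eqI[OF ad_in_Der[OF w] zero_in_Der])
    show "ad (A_sub h) w weyl_x = 0 weyl_x" by (simp add: ad_def wx)
    show "ad (A_sub h) w (y_hat h) = 0 (y_hat h)"
      using y by (simp add: ad_def z1 s0 weyl_poly_0)
  qed
qed

lemma S_subspace: "module.subspace smult S"
proof -
  interpret P: vector_space "smult :: 'f \<Rightarrow> 'f poly \<Rightarrow> 'f poly" by (rule vector_space_smult)
  show ?thesis
    unfolding P.subspace_def by (auto simp: S_def) (metis add_0_left)+
qed

lemma S_eq_span: "S = module.span smult {monom 1 i | i. i < m \<and> \<not> [i + 1 = m] (mod p)}"
proof -
  interpret P: vector_space "smult :: 'f \<Rightarrow> 'f poly \<Rightarrow> 'f poly" by (rule vector_space_smult)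
  let ?B = "{monom 1 i | i. i < m \<and> \<not> [i + 1 = m] (mod p)} :: 'f poly set"
  show ?thesis
  proof
    show "P.span ?B \<subseteq> S"
      by (rule P.span_minimal[OF _ S_subspace]) (auto simp: S_def split: if_splits)
    show "S \<subseteq> P.span ?B"
    proof
      fix s assume s: "s \<in> S"
      have "monom (coeff s i) i \<in> P.span ?B" for i
      proof (cases "coeff s i = 0")
        case False
        then have "monom 1 i \<in> ?B" using s by (auto simp: S_def)
        then have "smult (coeff s i) (monom 1 i) \<in> P.span ?B"
          by (intro P.span_scale P.span_base)
        then show ?thesis by (simp add: smult_monom)
      qed (simp add: P.span_zero)
      then have "(\<Sum>i\<le>Polynomial.degree s. monom (coeff s i) i) \<in> P.span ?B"
        by (intro P.span_sum)
      then show "s \<in> P.span ?B" by (simp add: poly_as_sum_of_monoms)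
    qed
  qed
qed

theorem Der_direct_sum:
  "is_direct_sum fun_scale (Der (A_sub h))
     [center_multiples (A_sub h) (D_der h (monom 1 r)),
      center_multiples (A_sub h) (\<lambda>a. weyl_x ^ e * E_x a),
      D_der h ` S,
      ad (A_sub h) ` normalizer (A_sub h)]"
  unfolding E_def[symmetric]
proof (rule is_direct_sum_4I)
  let ?D = "\<lambda>z. restrict0 (A_sub h) (\<lambda>a. z * D_der h (monom 1 r) a)"
  let ?E = "\<lambda>z. restrict0 (A_sub h) (\<lambda>a. z * E a)"
  show "vector_space fun_scale" by (rule vector_space_fun_scale)
  show "module.subspace fun_scale (center_multiples (A_sub h) (D_der h (monom 1 r)))"
    "module.subspace fun_scale (center_multiples (A_sub h) E)"
    "module.subspace fun_scale (D_der h ` S)"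
    "module.subspace fun_scale (ad (A_sub h) ` normalizer (A_sub h))"
    by (intro center_mult_subspace D_der_image_subspace S_subspace ad_normalizer_subspace)+
  show "a + b + c + d \<in> Der (A_sub h)"
    if "a \<in> center_multiples (A_sub h) (D_der h (monom 1 r))" "b \<in> center_multiples (A_sub h) E"
      "c \<in> D_der h ` S" "d \<in> ad (A_sub h) ` normalizer (A_sub h)" for a b c d
    using that unfolding center_multiples_def
    by (auto intro!: add_in_Der center_mult_in_Der D_der restrict_E_in_Der ad_in_Der)
  show "\<exists>a\<in>center_multiples (A_sub h) (D_der h (monom 1 r)). \<exists>b\<in>center_multiples (A_sub h) E.
      \<exists>c\<in>D_der h ` S. \<exists>d\<in>ad (A_sub h) ` normalizer (A_sub h). v = a + b + c + d"
    if v: "v \<in> Der (A_sub h)" for v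
  proof -
    obtain z1 z2 s w where "z1 \<in> center (A_sub h)" "z2 \<in> center (A_sub h)" "s \<in> S"
      "w \<in> normalizer (A_sub h)" "v = ?D z1 + ?E z2 + D_der h s + ad (A_sub h) w"
      by (rule Der_decomposition[OF v])
    then show ?thesis unfolding center_multiples_def by blast
  qed
  show "a = 0 \<and> b = 0 \<and> c = 0 \<and> d = 0"
    if mem: "a \<in> center_multiples (A_sub h) (D_der h (monom 1 r))" "b \<in> center_multiples (A_sub h) E"
      "c \<in> D_der h ` S" "d \<in> ad (A_sub h) ` normalizer (A_sub h)" and sum: "a + b + c + d = 0" for a b c d
  proof -
    obtain z1 z2 s w where abcd: "a = ?D z1" "b = ?E z2" "c = D_der h s" "d = ad (A_sub h) w"
      and zs: "z1 \<in> center (A_sub h)" "z2 \<in> center (A_sub h)" "s \<in> S" "w \<in> normalizer (A_sub h)"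
      using mem unfolding center_multiples_def by blast
    note 0 = Der_decomposition_unique[OF zs sum[unfolded abcd]]
    have "D_der h 0 = 0"
      by (rule Der_eqI[OF D_der(1) zero_in_Der]) (simp_all add: D_der weyl_poly_0)
    then show ?thesis
      by (auto simp: abcd 0 restrict0_def)
  qed
qed

end

theorem corollary6p24:
  fixes p m k n :: nat
    and h :: "'f::field poly"
    and S :: "'f poly set"
  assumes "CHAR('f) = p" and "p > 0"
    and "m = k * p + n" and "n < p"
    and "h = monom 1 m"
    and "S = module.span smult {monom 1 i | i. i < m \<and> \<not> [int i = int n - 1] (mod int p)}"
  shows "(n = 0 \<longrightarrow>
            is_direct_sum fun_scale (Der (A_sub h))
              [center_multiples (A_sub h) (D_der h (monom 1 (p - 1))),
               center_multiples (A_sub h) (\<lambda>a. weyl_x ^ (m * (p - 1)) * E_x a),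
               D_der h ` S,
               ad (A_sub h) ` normalizer (A_sub h)]) \<and>
         (1 \<le> n \<longrightarrow>
            is_direct_sum fun_scale (Der (A_sub h))
              [center_multiples (A_sub h) (D_der h (monom 1 (n - 1))),
               center_multiples (A_sub h) (\<lambda>a. weyl_x ^ ((m - k) * p) * E_x a),
               D_der h ` S,
               ad (A_sub h) ` normalizer (A_sub h)])"
proof -
  have "[int i = int n - 1] (mod int p) \<longleftrightarrow> [i + 1 = m] (mod p)" for i
  proof -
    have "[int i = int n - 1] (mod int p) \<longleftrightarrow> [int i + 1 = int n] (mod int p)"
      using cong_add_rcancel[of "int i" 1 "int n - 1" "int p"] by simp
    also have "\<dots> \<longleftrightarrow> [i + 1 = n] (mod p)"
      using cong_int_iff[of "i + 1" n p] by (simp add: add.commute)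
    also have "\<dots> \<longleftrightarrow> [i + 1 = m] (mod p)"
      by (simp add: assms(3) cong_def)
    finally show ?thesis .
  qed
  then have S: "S = module.span smult {monom 1 i | i. i < m \<and> \<not> [i + 1 = m] (mod p)}"
    using assms(6) by simp
  have main: "is_direct_sum fun_scale (Der (A_sub h))
     [center_multiples (A_sub h) (D_der h (monom 1 r)),
      center_multiples (A_sub h) (\<lambda>a. weyl_x ^ e * E_x a),
      D_der h ` S, ad (A_sub h) ` normalizer (A_sub h)]"
    if "r < p" "[r + 1 = m] (mod p)" "p dvd e" "m * (p - 1) \<le> e" "e < m * (p - 1) + p" for r e
  proof -
    interpret weyl_monomial p h m r e
      using assms that by unfold_locales auto
    show ?thesis using Der_direct_sum by (simp add: S S_eq_span)
  qed
  show ?thesis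
  proof (intro conjI impI)
    assume "n = 0"
    then show "is_direct_sum fun_scale (Der (A_sub h))
        [center_multiples (A_sub h) (D_der h (monom 1 (p - 1))),
         center_multiples (A_sub h) (\<lambda>a. weyl_x ^ (m * (p - 1)) * E_x a),
         D_der h ` S, ad (A_sub h) ` normalizer (A_sub h)]"
      using assms(2,3) by (intro main) (auto simp: cong_def)
  next
    assume n: "1 \<le> n"
    have "m * p = m * (p - 1) + m"
      using assms(2) by (cases p) simp_all
    then have e: "(m - k) * p = m * (p - 1) + n"
      using assms(3) by (simp add: diff_mult_distrib)
    show "is_direct_sum fun_scale (Der (A_sub h))
        [center_multiples (A_sub h) (D_der h (monom 1 (n - 1))),
         center_multiples (A_sub h) (\<lambda>a. weyl_x ^ ((m - k) * p) * E_x a),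
         D_der h ` S, ad (A_sub h) ` normalizer (A_sub h)]"
    proof (rule main)
      show "p dvd (m - k) * p" by simp
      show "m * (p - 1) \<le> (m - k) * p" "(m - k) * p < m * (p - 1) + p"
        unfolding e using assms(4) by simp_all
      show "n - 1 < p" "[n - 1 + 1 = m] (mod p)"
        using assms(3,4) n by (simp_all add: cong_def)
    qed
  qed
qed

end
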